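(* Let $G$ be a compact real Lie group or a compact $p$-adic Lie group, endowed with a compatible metric $d$. If $X$ and $Y$ are subsets of $G$ with $XY=G$, then $\overline{\dim}\,X+\overline{\dim}\,Y\ge\dim G$. In particular, if $X\subseteq G$ satisfies $X^2=G$, then $\overline{\dim}\,X\ge(\dim G)/2$.
   Context: For a (nonempty) bounded metric space $X$ and $\delta>0$, the $\delta$-packing number $N_\delta(X)$ is the maximum number of pairwise disjoint open balls of radius $\delta$ in $X$. The upper Minkowski dimension of $X$ is $\overline{\dim}\,X=\limsup_{\delta\to0^+}\frac{-\log N_\delta(X)}{\log\delta}$. Subsets of $G$ carry the restricted metric. A metric $d$ on a compact real (resp. $p$-adic) Lie group $G$ is compatible if it is invariant under left and right translations by $G$ and there is a coordinate map (chart) from some open neighborhood of the identity $e$ to an open subset of $\mathbb{R}^n$ (resp. $\mathbb{Q}_p^n$) which is bi-Lipschitz on some neighborhood of $e$. Here $\mathbb{R}^n$ has its usual metric and $\mathbb{Q}_p^n$ has the maximum metric coming from $|x-y|_p$, with $|p|_p=1/p$. $\dim G$ is the dimension of $G$ as a real (resp. $p$-adic analytic) manifold. For subsets $X,Y$ of $G$, $XY=\{xy\mid x\in X,\ y\in Y\}$ and $X^2=XX$. *)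

theory Defs
  imports
    "HOL-Analysis.Analysis"
    "HOL-Algebra.Coset"
    "Berlekamp_Zassenhaus.Finite_Field"
begin

section \<open>The field of p-adic numbers\<close>

subsection \<open>The p-adic absolute value on the rationals\<close>

definition padic_abs :: "nat \<Rightarrow> rat \<Rightarrow> real" where
  "padic_abs p x =
     (if x = 0 then 0
      else real p powi (int (multiplicity (int p) (snd (quotient_of x)))
                      - int (multiplicity (int p) (fst (quotient_of x)))))"

lemma padic_abs_0 [simp]: "padic_abs p 0 = 0"
  by (simp add: padic_abs_def)

lemma padic_abs_Fract:
  assumes p: "prime p" and a: "a \<noteq> 0" and b: "b \<noteq> 0"
  shows "padic_abs p (of_int a / of_int b) =
    real p powi (int (multiplicity (int p) b) - int (multiplicity (int p) a))"
proof -
  define x :: rat where "x = of_int a / of_int b"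
  obtain c d where q: "quotient_of x = (c, d)" by (cases "quotient_of x")
  have d: "d > 0" using quotient_of_denom_pos[OF q] .
  have x: "x = of_int c / of_int d" using quotient_of_div[OF q] .
  have x0: "x \<noteq> 0" using a b by (simp add: x_def)
  then have c: "c \<noteq> 0" using x by auto
  have "(of_int (a * d) :: rat) = of_int (c * b)"
    using x b d unfolding x_def by (simp add: field_simps)
  then have eq: "a * d = c * b" by (simp only: of_int_eq_iff)
  have pe: "prime_elem (int p)" using p by simp
  have "multiplicity (int p) (a * d) = multiplicity (int p) a + multiplicity (int p) d"
    by (rule prime_elem_multiplicity_mult_distrib) (use pe a d in auto)
  moreover have "multiplicity (int p) (c * b) = multiplicity (int p) c + multiplicity (int p) b"
    by (rule prime_elem_multiplicity_mult_distrib) (use pe c b in auto)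
  ultimately have "int (multiplicity (int p) d) - int (multiplicity (int p) c)
      = int (multiplicity (int p) b) - int (multiplicity (int p) a)"
    by (simp add: eq)
  then show ?thesis using x0 q unfolding x_def[symmetric] padic_abs_def by simp
qed

lemma rat_fraction_cases:
  fixes x :: rat
  assumes "x \<noteq> 0"
  obtains a b :: int where "a \<noteq> 0" "b \<noteq> 0" "x = of_int a / of_int b"
proof -
  obtain c d where q: "quotient_of x = (c, d)" by (cases "quotient_of x")
  show ?thesis
    using that[of c d] quotient_of_div[OF q] quotient_of_denom_pos[OF q] assms by auto
qed

lemma padic_abs_nonneg [simp]: "padic_abs p x \<ge> 0"
  by (simp add: padic_abs_def)

lemma padic_abs_eq_0_iff: "prime p \<Longrightarrow> padic_abs p x = 0 \<longleftrightarrow> x = 0"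
  by (auto simp: padic_abs_def power_int_0_left_if)

lemma padic_abs_1: "prime p \<Longrightarrow> padic_abs p 1 = 1"
  using padic_abs_Fract[of p 1 1] by simp

lemma padic_abs_prime: "prime p \<Longrightarrow> padic_abs p (of_nat p) = 1 / real p"
  using padic_abs_Fract[of p "int p" 1] prime_gt_0_nat[of p]
  by (simp add: power_int_minus divide_inverse)

lemma padic_abs_mult:
  assumes p: "prime p"
  shows "padic_abs p (x * y) = padic_abs p x * padic_abs p y"
proof (cases "x = 0 \<or> y = 0")
  case False
  then obtain a b c d :: int where ab: "a \<noteq> 0" "b \<noteq> 0" "x = of_int a / of_int b"
    and cd: "c \<noteq> 0" "d \<noteq> 0" "y = of_int c / of_int d"
    by (metis rat_fraction_cases)
  have pe: "prime_elem (int p)" using p by simp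
  have xy: "x * y = of_int (a * c) / of_int (b * d)" by (simp add: ab cd)
  have "real p \<noteq> 0" using p prime_gt_0_nat by auto
  moreover have "multiplicity (int p) (a * c) = multiplicity (int p) a + multiplicity (int p) c"
    by (rule prime_elem_multiplicity_mult_distrib) (use pe ab cd in auto)
  moreover have "multiplicity (int p) (b * d) = multiplicity (int p) b + multiplicity (int p) d"
    by (rule prime_elem_multiplicity_mult_distrib) (use pe ab cd in auto)
  moreover have "padic_abs p (x * y) =
      real p powi (int (multiplicity (int p) (b * d)) - int (multiplicity (int p) (a * c)))"
    unfolding xy by (rule padic_abs_Fract) (use p ab cd in auto)
  moreover have "padic_abs p x = real p powi (int (multiplicity (int p) b) - int (multiplicity (int p) a))"
    unfolding ab(3) by (rule padic_abs_Fract) (use p ab in auto)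
  moreover have "padic_abs p y = real p powi (int (multiplicity (int p) d) - int (multiplicity (int p) c))"
    unfolding cd(3) by (rule padic_abs_Fract) (use p cd in auto)
  ultimately show ?thesis by (simp add: power_int_add[symmetric] algebra_simps)
qed auto

lemma padic_abs_minus [simp]: "padic_abs p (- x) = padic_abs p x"
proof -
  have "quotient_of (- x) = (- fst (quotient_of x), snd (quotient_of x))"
    by (simp add: rat_uminus_code split: prod.split)
  moreover have "multiplicity (int p) (- a) = multiplicity (int p) a" for a
    using multiplicity_times_unit_right[of "-1" "int p" a] by simp
  ultimately show ?thesis
    by (simp add: padic_abs_def)
qed

lemma padic_abs_minus_commute: "padic_abs p (x - y) = padic_abs p (y - x)"
  by (metis padic_abs_minus minus_diff_eq)

lemma padic_abs_ultrametric:
  assumes p: "prime p"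
  shows "padic_abs p (x + y) \<le> max (padic_abs p x) (padic_abs p y)"
proof (cases "x = 0 \<or> y = 0 \<or> x + y = 0")
  case True
  then show ?thesis by (auto simp: le_max_iff_disj)
next
  case False
  then obtain a0 b0 c0 d0 :: int where ab: "a0 \<noteq> 0" "b0 \<noteq> 0" "x = of_int a0 / of_int b0"
    and cd: "c0 \<noteq> 0" "d0 \<noteq> 0" "y = of_int c0 / of_int d0"
    by (metis rat_fraction_cases)
  define a c b where "a = a0 * d0" and "c = c0 * b0" and "b = b0 * d0"
  have ne: "a \<noteq> 0" "c \<noteq> 0" "b \<noteq> 0" using ab cd by (auto simp: a_def c_def b_def)
  have x: "x = of_int a / of_int b" and y: "y = of_int c / of_int b"
    using ab cd by (auto simp: a_def c_def b_def)
  have xy: "x + y = of_int (a + c) / of_int b" by (simp add: x y add_divide_distrib)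
  have ac: "a + c \<noteq> 0" using False xy by auto
  let ?m = "\<lambda>z. multiplicity (int p) z"
  have "int p ^ min (?m a) (?m c) dvd a + c"
    by (intro dvd_add multiplicity_dvd') auto
  moreover have "\<not> is_unit (int p)" using p by (metis not_prime_unit prime_int_nat_transfer prime_nat_int_transfer)
  ultimately have le: "min (?m a) (?m c) \<le> ?m (a + c)"
    using ac by (intro multiplicity_geI) auto
  have p1: "1 \<le> real p" using p prime_ge_1_nat by auto
  have "padic_abs p (x + y) = real p powi (int (?m b) - int (?m (a + c)))"
    unfolding xy by (rule padic_abs_Fract) (use p ac ne in auto)
  also have "\<dots> \<le> real p powi (int (?m b) - int (min (?m a) (?m c)))"
    by (rule power_int_increasing) (use le p1 in auto)
  also have "\<dots> \<le> max (real p powi (int (?m b) - int (?m a))) (real p powi (int (?m b) - int (?m c)))"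
    by (cases "?m a \<le> ?m c") (auto simp: min_def)
  also have "\<dots> = max (padic_abs p x) (padic_abs p y)"
    unfolding x y using padic_abs_Fract[OF p] ne by simp
  finally show ?thesis .
qed

lemma padic_abs_triangle: "prime p \<Longrightarrow> padic_abs p (x + y) \<le> padic_abs p x + padic_abs p y"
  using padic_abs_ultrametric[of p x y] padic_abs_nonneg[of p x] padic_abs_nonneg[of p y] by linarith

lemma padic_abs_diff_triangle:
  "prime p \<Longrightarrow> \<bar>padic_abs p x - padic_abs p y\<bar> \<le> padic_abs p (x - y)"
  using padic_abs_triangle[of p "x - y" y] padic_abs_triangle[of p "y - x" x]
    padic_abs_minus_commute[of p x y] by simp

lemma padic_abs_inverse:
  assumes "prime p" shows "padic_abs p (inverse x) = inverse (padic_abs p x)"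
proof (cases "x = 0")
  case False
  then have "padic_abs p x * padic_abs p (inverse x) = 1"
    using assms by (simp add: padic_abs_mult[symmetric] padic_abs_1)
  then show ?thesis by (metis inverse_unique)
qed auto


subsection \<open>Completion\<close>

definition padic_Cauchy :: "nat \<Rightarrow> (nat \<Rightarrow> rat) \<Rightarrow> bool" where
  "padic_Cauchy p X \<longleftrightarrow> (\<forall>e>0. \<exists>k. \<forall>m\<ge>k. \<forall>n\<ge>k. padic_abs p (X m - X n) < e)"

definition padic_null :: "nat \<Rightarrow> (nat \<Rightarrow> rat) \<Rightarrow> bool" where
  "padic_null p X \<longleftrightarrow> (\<lambda>n. padic_abs p (X n)) \<longlonglongrightarrow> 0"

lemma padic_Cauchy_const [simp]: "padic_Cauchy p (\<lambda>n. c)"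
  by (simp add: padic_Cauchy_def)

lemma padic_null_minus: "padic_null p X \<Longrightarrow> padic_null p (\<lambda>n. - X n)"
  by (simp add: padic_null_def)

lemma padic_null_le:
  assumes "Y \<longlonglongrightarrow> 0" "\<And>n. padic_abs p (X n) \<le> Y n"
  shows "padic_null p X"
  unfolding padic_null_def
  by (rule tendsto_sandwich[OF _ _ tendsto_const assms(1)]) (use assms(2) in auto)

lemma padic_null_add:
  assumes "prime p" "padic_null p X" "padic_null p Y"
  shows "padic_null p (\<lambda>n. X n + Y n)"
  by (rule padic_null_le[of "\<lambda>n. padic_abs p (X n) + padic_abs p (Y n)"])
     (use assms tendsto_add[of _ 0 _ _ 0] padic_abs_triangle in \<open>auto simp: padic_null_def\<close>)

lemma padic_Cauchy_convergent:
  assumes p: "prime p" and X: "padic_Cauchy p X"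
  shows "convergent (\<lambda>n. padic_abs p (X n))"
proof -
  have "Cauchy (\<lambda>n. padic_abs p (X n))"
  proof (rule CauchyI)
    fix e :: real assume "e > 0"
    then obtain k where k: "\<forall>m\<ge>k. \<forall>n\<ge>k. padic_abs p (X m - X n) < e"
      using X unfolding padic_Cauchy_def by blast
    have "norm (padic_abs p (X m) - padic_abs p (X n)) < e" if "m \<ge> k" "n \<ge> k" for m n
      using k that padic_abs_diff_triangle[OF p, of "X m" "X n"] by fastforce
    then show "\<exists>M. \<forall>m\<ge>M. \<forall>n\<ge>M. norm (padic_abs p (X m) - padic_abs p (X n)) < e" by blast
  qed
  then show ?thesis by (simp add: Cauchy_convergent_iff)
qed

lemma padic_Cauchy_bounded:
  assumes "prime p" "padic_Cauchy p X"
  obtains B where "B > 0" "\<And>n. padic_abs p (X n) \<le> B"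
proof -
  have "Bseq (\<lambda>n. padic_abs p (X n))"
    using padic_Cauchy_convergent[OF assms] by (rule convergent_imp_Bseq)
  then show ?thesis using that by (auto simp: Bseq_def)
qed

lemma padic_null_mult_bounded:
  assumes p: "prime p" and X: "padic_Cauchy p X" and Y: "padic_null p Y"
  shows "padic_null p (\<lambda>n. X n * Y n)"
proof -
  obtain B where B: "B > 0" "\<And>n. padic_abs p (X n) \<le> B"
    using padic_Cauchy_bounded[OF p X] by blast
  show ?thesis
  proof (rule padic_null_le)
    show "(\<lambda>n. B * padic_abs p (Y n)) \<longlonglongrightarrow> 0"
      using tendsto_mult_left[of _ 0 sequentially B] Y by (auto simp: padic_null_def)
    show "padic_abs p (X n * Y n) \<le> B * padic_abs p (Y n)" for n
      using B by (simp add: padic_abs_mult[OF p] mult_right_mono)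
  qed
qed

lemma padic_CauchyI:
  assumes "\<And>e. e > 0 \<Longrightarrow> \<exists>k. \<forall>m\<ge>k. \<forall>n\<ge>k. padic_abs p (X m - X n) < C * e" and "C > 0"
  shows "padic_Cauchy p X"
  unfolding padic_Cauchy_def
proof (intro allI impI)
  fix e :: real assume "e > 0"
  then show "\<exists>k. \<forall>m\<ge>k. \<forall>n\<ge>k. padic_abs p (X m - X n) < e"
    using assms(1)[of "e / C"] \<open>C > 0\<close> by simp
qed

lemma padic_Cauchy_add:
  assumes p: "prime p" and X: "padic_Cauchy p X" and Y: "padic_Cauchy p Y"
  shows "padic_Cauchy p (\<lambda>n. X n + Y n)"
proof (rule padic_CauchyI[where C = 2])
  fix e :: real assume "e > 0"
  then obtain i j where i: "\<forall>m\<ge>i. \<forall>n\<ge>i. padic_abs p (X m - X n) < e"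
    and j: "\<forall>m\<ge>j. \<forall>n\<ge>j. padic_abs p (Y m - Y n) < e"
    using X Y unfolding padic_Cauchy_def by metis
  have "padic_abs p ((X m + Y m) - (X n + Y n)) < 2 * e" if "m \<ge> max i j" "n \<ge> max i j" for m n
  proof -
    have "padic_abs p (X m - X n) < e" "padic_abs p (Y m - Y n) < e"
      using i j that by auto
    then show ?thesis
      using padic_abs_triangle[OF p, of "X m - X n" "Y m - Y n"] by (simp add: add_diff_add)
  qed
  then show "\<exists>k. \<forall>m\<ge>k. \<forall>n\<ge>k. padic_abs p ((X m + Y m) - (X n + Y n)) < 2 * e" by blast
qed auto

lemma padic_Cauchy_minus: "padic_Cauchy p X \<Longrightarrow> padic_Cauchy p (\<lambda>n. - X n)"
  unfolding padic_Cauchy_def minus_diff_minus padic_abs_minus .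

lemma padic_Cauchy_mult:
  assumes p: "prime p" and X: "padic_Cauchy p X" and Y: "padic_Cauchy p Y"
  shows "padic_Cauchy p (\<lambda>n. X n * Y n)"
proof -
  obtain A where A: "A > 0" "\<And>n. padic_abs p (X n) \<le> A"
    using padic_Cauchy_bounded[OF p X] by blast
  obtain B where B: "B > 0" "\<And>n. padic_abs p (Y n) \<le> B"
    using padic_Cauchy_bounded[OF p Y] by blast
  show ?thesis
  proof (rule padic_CauchyI[where C = "A + B"])
    fix e :: real assume "e > 0"
    then obtain i j where i: "\<forall>m\<ge>i. \<forall>n\<ge>i. padic_abs p (X m - X n) < e"
      and j: "\<forall>m\<ge>j. \<forall>n\<ge>j. padic_abs p (Y m - Y n) < e"
      using X Y unfolding padic_Cauchy_def by metis
    have "padic_abs p (X m * Y m - X n * Y n) < (A + B) * e"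
      if "m \<ge> max i j" "n \<ge> max i j" for m n
    proof -
      have "padic_abs p (X m - X n) < e" "padic_abs p (Y m - Y n) < e"
        using i j that by auto
      then have "padic_abs p (X m) * padic_abs p (Y m - Y n) \<le> A * padic_abs p (Y m - Y n)"
        "A * padic_abs p (Y m - Y n) < A * e"
        "padic_abs p (X m - X n) * padic_abs p (Y n) \<le> padic_abs p (X m - X n) * B"
        "padic_abs p (X m - X n) * B < e * B"
        using A B by (auto intro: mult_right_mono mult_left_mono)
      then show ?thesis
        using padic_abs_triangle[OF p, of "X m * (Y m - Y n)" "(X m - X n) * Y n"]
        unfolding mult_diff_mult padic_abs_mult[OF p] by (simp add: algebra_simps)
    qed
    then show "\<exists>k. \<forall>m\<ge>k. \<forall>n\<ge>k. padic_abs p (X m * Y m - X n * Y n) < (A + B) * e" by blast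
  qed (use A B in auto)
qed

lemma padic_not_null_bounded_below:
  assumes p: "prime p" and X: "padic_Cauchy p X" and nz: "\<not> padic_null p X"
  obtains b k where "b > 0" "\<And>n. n \<ge> k \<Longrightarrow> b < padic_abs p (X n)"
proof -
  obtain L where L: "(\<lambda>n. padic_abs p (X n)) \<longlonglongrightarrow> L"
    using padic_Cauchy_convergent[OF p X] unfolding convergent_def by blast
  have "L \<ge> 0" by (rule LIMSEQ_le_const[OF L]) auto
  with nz L have "L > 0" by (cases "L = 0") (auto simp: padic_null_def)
  then have "eventually (\<lambda>n. L / 2 < padic_abs p (X n)) sequentially"
    using order_tendstoD(1)[OF L, of "L / 2"] by simp
  then show ?thesis using that[of "L / 2"] \<open>L > 0\<close> by (auto simp: eventually_sequentially)
qed

lemma padic_abs_inverse_diff: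
  assumes p: "prime p" and b: "b > 0" "b < padic_abs p x" "b < padic_abs p y"
  shows "padic_abs p (inverse x - inverse y) \<le> inverse (b * b) * padic_abs p (x - y)"
proof -
  have ne: "x \<noteq> 0" "y \<noteq> 0" using b by auto
  then have "inverse x - inverse y = (y - x) * (inverse x * inverse y)"
    by (simp add: field_simps)
  then have "padic_abs p (inverse x - inverse y)
      = padic_abs p (x - y) * inverse (padic_abs p x * padic_abs p y)"
    by (simp add: padic_abs_mult[OF p] padic_abs_inverse[OF p] padic_abs_minus_commute[of p y])
  also have "\<dots> \<le> padic_abs p (x - y) * inverse (b * b)"
    by (intro mult_left_mono le_imp_inverse_le mult_mono) (use b in auto)
  finally show ?thesis by (simp add: mult.commute)
qed

lemma padic_Cauchy_inverse:
  assumes p: "prime p" and X: "padic_Cauchy p X" and nz: "\<not> padic_null p X"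
  shows "padic_Cauchy p (\<lambda>n. inverse (X n))"
proof -
  obtain b k where b: "b > 0" "\<And>n. n \<ge> k \<Longrightarrow> b < padic_abs p (X n)"
    using padic_not_null_bounded_below[OF assms] by blast
  show ?thesis
  proof (rule padic_CauchyI[where C = "inverse (b * b)"])
    fix e :: real assume "e > 0"
    then obtain i where i: "\<forall>m\<ge>i. \<forall>n\<ge>i. padic_abs p (X m - X n) < e"
      using X unfolding padic_Cauchy_def by metis
    have "padic_abs p (inverse (X m) - inverse (X n)) < inverse (b * b) * e"
      if "m \<ge> max i k" "n \<ge> max i k" for m n
    proof -
      have "padic_abs p (inverse (X m) - inverse (X n)) \<le> inverse (b * b) * padic_abs p (X m - X n)"
        by (rule padic_abs_inverse_diff) (use p b that in auto)
      also have "\<dots> < inverse (b * b) * e"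
        by (rule mult_strict_left_mono) (use b i that in auto)
      finally show ?thesis .
    qed
    then show "\<exists>k. \<forall>m\<ge>k. \<forall>n\<ge>k.
        padic_abs p (inverse (X m) - inverse (X n)) < inverse (b * b) * e" by blast
  qed (use b in auto)
qed

lemma padic_null_diff_inverse:
  assumes p: "prime p" and X: "padic_Cauchy p X" "\<not> padic_null p X"
    and Y: "padic_Cauchy p Y" "\<not> padic_null p Y" and XY: "padic_null p (\<lambda>n. X n - Y n)"
  shows "padic_null p (\<lambda>n. inverse (X n) - inverse (Y n))"
proof -
  obtain b k where b: "b > 0" "\<And>n. n \<ge> k \<Longrightarrow> b < padic_abs p (X n)"
    using padic_not_null_bounded_below[OF p X] by blast
  obtain c l where c: "c > 0" "\<And>n. n \<ge> l \<Longrightarrow> c < padic_abs p (Y n)"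
    using padic_not_null_bounded_below[OF p Y] by blast
  define a where "a = min b c"
  have "a > 0" using b c by (simp add: a_def)
  have lim: "(\<lambda>n. inverse (a * a) * padic_abs p (X n - Y n)) \<longlonglongrightarrow> 0"
    using tendsto_mult_left[of _ 0 sequentially "inverse (a * a)"] XY by (auto simp: padic_null_def)
  have "padic_abs p (inverse (X n) - inverse (Y n)) \<le> inverse (a * a) * padic_abs p (X n - Y n)"
    if "n \<ge> max k l" for n
    by (rule padic_abs_inverse_diff) (use p \<open>a > 0\<close> b(2)[of n] c(2)[of n] that in \<open>auto simp: a_def\<close>)
  then have "eventually (\<lambda>n. padic_abs p (inverse (X n) - inverse (Y n))
      \<le> inverse (a * a) * padic_abs p (X n - Y n)) sequentially"
    unfolding eventually_sequentially by blast
  then show ?thesis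
    unfolding padic_null_def using tendsto_sandwich[OF _ _ tendsto_const lim] by auto
qed

definition padic_rel :: "nat \<Rightarrow> (nat \<Rightarrow> rat) \<Rightarrow> (nat \<Rightarrow> rat) \<Rightarrow> bool" where
  "padic_rel p X Y \<longleftrightarrow> padic_Cauchy p X \<and> padic_Cauchy p Y \<and> padic_null p (\<lambda>n. X n - Y n)"

lemma padic_rel_refl: "padic_Cauchy p X \<Longrightarrow> padic_rel p X X"
  by (simp add: padic_rel_def padic_null_def)

lemma part_equivp_padic_rel:
  assumes p: "prime p" shows "part_equivp (padic_rel p)"
proof (rule part_equivpI)
  show "\<exists>X. padic_rel p X X" using padic_rel_refl padic_Cauchy_const by blast
  show "symp (padic_rel p)"
    by (auto simp: symp_def padic_rel_def padic_null_def padic_abs_minus_commute)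
  show "transp (padic_rel p)"
  proof (rule transpI)
    fix X Y Z assume "padic_rel p X Y" "padic_rel p Y Z"
    then show "padic_rel p X Z"
      using padic_null_add[OF p, of "\<lambda>n. X n - Y n" "\<lambda>n. Y n - Z n"]
      by (auto simp: padic_rel_def)
  qed
qed

text \<open>The prime is carried by the type parameter: \<open>'a padic\<close> is the completion of the rationals
  for the absolute value belonging to the prime \<open>CARD('a)\<close>.\<close>

typedef (overloaded) 'a padic =
  "{S. \<exists>X. padic_Cauchy CARD('a::prime_card) X \<and> S = Collect (padic_rel CARD('a) X)}"
  morphisms padic_class Abs_padic
  using padic_Cauchy_const by blast

definition padic_of_seq :: "(nat \<Rightarrow> rat) \<Rightarrow> 'a::prime_card padic" where
  "padic_of_seq X = Abs_padic (Collect (padic_rel CARD('a) X))"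

definition padic_seq :: "'a::prime_card padic \<Rightarrow> nat \<Rightarrow> rat" where
  "padic_seq x = (SOME X. X \<in> padic_class x)"

definition cr_padic :: "(nat \<Rightarrow> rat) \<Rightarrow> 'a::prime_card padic \<Rightarrow> bool" where
  "cr_padic = (\<lambda>X x. padic_rel CARD('a) X X \<and> padic_of_seq X = x)"

lemma Quotient_padic:
  "Quotient (padic_rel CARD('a::prime_card)) padic_of_seq padic_seq (cr_padic :: _ \<Rightarrow> 'a padic \<Rightarrow> bool)"
proof (rule QuotientI)
  let ?R = "padic_rel CARD('a)"
  have R: "symp ?R" "transp ?R"
    using part_equivp_padic_rel[of "CARD('a)"] prime_card[where 'a = 'a] by (auto elim: part_equivpE)
  have class_eq: "Collect (?R X) = Collect (?R Y)" if "?R X Y" for X Y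
    using that R by (blast dest: sympD transpD)
  have class_of: "padic_class (padic_of_seq X :: 'a padic) = Collect (?R X)" if "padic_Cauchy CARD('a) X" for X
    unfolding padic_of_seq_def by (rule Abs_padic_inverse) (use that in blast)
  have seq: "padic_seq x \<in> padic_class x" for x :: "'a padic"
  proof -
    obtain X where "padic_Cauchy CARD('a) X" "padic_class x = Collect (?R X)"
      using padic_class[of x] by blast
    then have "\<exists>Y. Y \<in> padic_class x" using padic_rel_refl by blast
    then show ?thesis unfolding padic_seq_def by (rule someI_ex)
  qed
  show *: "?R (padic_seq x) (padic_seq x)" for x :: "'a padic"
    using padic_class[of x] seq[of x] by (auto simp: padic_rel_def padic_null_def)
  show "padic_of_seq (padic_seq x) = x" for x :: "'a padic"
  proof -
    obtain X where "padic_class x = Collect (?R X)"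
      using padic_class[of x] by blast
    with seq[of x] have "Collect (?R (padic_seq x)) = padic_class x"
      using class_eq by auto
    then show ?thesis by (simp add: padic_of_seq_def padic_class_inverse)
  qed
  show "?R X Y \<longleftrightarrow> ?R X X \<and> ?R Y Y \<and> padic_of_seq X = (padic_of_seq Y :: 'a padic)" for X Y
  proof
    assume "?R X Y"
    then show "?R X X \<and> ?R Y Y \<and> padic_of_seq X = (padic_of_seq Y :: 'a padic)"
      using class_eq padic_rel_refl by (auto simp: padic_of_seq_def padic_rel_def)
  next
    assume H: "?R X X \<and> ?R Y Y \<and> padic_of_seq X = (padic_of_seq Y :: 'a padic)"
    then have "Collect (?R X) = Collect (?R Y)"
      using class_of[of X] class_of[of Y] by (auto simp: padic_rel_def)
    with H show "?R X Y" by auto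
  qed
  show "cr_padic = (\<lambda>X x. ?R X X \<and> padic_of_seq X = (x :: 'a padic))"
    by (rule cr_padic_def)
qed

setup_lifting Quotient_padic

lemma padic_cases:
  obtains X where "padic_rel CARD('a) X X" "x = (padic_of_seq X :: 'a::prime_card padic)"
  using Quotient_rep_reflp[OF Quotient_padic] Quotient_abs_rep[OF Quotient_padic] by metis

lemma padic_of_seq_eq_iff:
  assumes "padic_rel CARD('a) X X" "padic_rel CARD('a) Y Y"
  shows "padic_of_seq X = (padic_of_seq Y :: 'a::prime_card padic) \<longleftrightarrow> padic_rel CARD('a) X Y"
  using Quotient_rel[OF Quotient_padic] assms by blast

instantiation padic :: (prime_card) field
begin

lift_definition zero_padic :: "'a padic" is "\<lambda>n. 0"
  by (simp add: padic_rel_refl)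

lift_definition one_padic :: "'a padic" is "\<lambda>n. 1"
  by (simp add: padic_rel_refl)

lift_definition plus_padic :: "'a padic \<Rightarrow> 'a padic \<Rightarrow> 'a padic" is "\<lambda>X Y n. X n + Y n"
  unfolding padic_rel_def add_diff_add
  by (simp add: padic_Cauchy_add padic_null_add prime_card)

lift_definition uminus_padic :: "'a padic \<Rightarrow> 'a padic" is "\<lambda>X n. - X n"
  unfolding padic_rel_def minus_diff_minus
  by (simp only: padic_Cauchy_minus padic_null_minus simp_thms)

lift_definition times_padic :: "'a padic \<Rightarrow> 'a padic \<Rightarrow> 'a padic" is "\<lambda>X Y n. X n * Y n"
proof -
  let ?p = "CARD('a)"
  have p: "prime ?p" by (rule prime_card)
  fix X X' Y Y'
  assume *: "padic_rel ?p X X'" "padic_rel ?p Y Y'"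
  then have "padic_null ?p (\<lambda>n. X n * (Y n - Y' n) + Y' n * (X n - X' n))"
    by (intro padic_null_add padic_null_mult_bounded) (auto simp: p padic_rel_def)
  also have "(\<lambda>n. X n * (Y n - Y' n) + Y' n * (X n - X' n)) = (\<lambda>n. X n * Y n - X' n * Y' n)"
    by (simp add: algebra_simps)
  finally show "padic_rel ?p (\<lambda>n. X n * Y n) (\<lambda>n. X' n * Y' n)"
    using * p by (auto simp: padic_rel_def intro: padic_Cauchy_mult)
qed

lift_definition inverse_padic :: "'a padic \<Rightarrow> 'a padic"
  is "\<lambda>X. if padic_null CARD('a) X then (\<lambda>n. 0) else (\<lambda>n. inverse (X n))"
proof -
  let ?p = "CARD('a)"
  have p: "prime ?p" by (rule prime_card)
  fix X Y assume "padic_rel ?p X Y"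
  then have X: "padic_Cauchy ?p X" and Y: "padic_Cauchy ?p Y"
    and XY: "padic_null ?p (\<lambda>n. X n - Y n)"
    by (simp_all add: padic_rel_def)
  have "padic_null ?p X \<longleftrightarrow> padic_null ?p Y"
  proof
    assume "padic_null ?p X"
    from padic_null_add[OF p padic_null_minus[OF XY] this] show "padic_null ?p Y" by simp
  next
    assume "padic_null ?p Y"
    from padic_null_add[OF p XY this] show "padic_null ?p X" by simp
  qed
  moreover have "padic_null ?p (\<lambda>n. 0)" by (simp add: padic_null_def)
  ultimately show "?thesis X Y"
    by (simp add: padic_null_diff_inverse padic_Cauchy_inverse p X Y XY padic_rel_def)
qed

definition "x - y = x + - y" for x y :: "'a padic"

definition "x div y = x * inverse y" for x y :: "'a padic"

instance
proof
  let ?p = "CARD('a)"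
  have p: "prime ?p" by (rule prime_card)
  have relI: "padic_rel ?p X Y" if "padic_Cauchy ?p X" "X = Y" for X Y
    using that padic_rel_refl by auto
  note cauchy = padic_Cauchy_add[OF p] padic_Cauchy_minus padic_Cauchy_mult[OF p] padic_Cauchy_const
  fix a b c :: "'a padic"
  show "a + b = b + a"
    by transfer (rule relI, auto simp: padic_rel_def ac_simps intro!: cauchy)
  show "(a + b) + c = a + (b + c)"
    by transfer (rule relI, auto simp: padic_rel_def ac_simps intro!: cauchy)
  show "0 + a = a"
    by transfer (rule relI, auto simp: padic_rel_def intro!: cauchy)
  show "- a + a = 0"
    by transfer (rule relI, auto simp: padic_rel_def intro!: cauchy)
  show "a - b = a + - b"
    by (rule minus_padic_def)
  show "(a * b) * c = a * (b * c)"
    by transfer (rule relI, auto simp: padic_rel_def ac_simps intro!: cauchy)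
  show "a * b = b * a"
    by transfer (rule relI, auto simp: padic_rel_def ac_simps intro!: cauchy)
  show "1 * a = a"
    by transfer (rule relI, auto simp: padic_rel_def intro!: cauchy)
  show "(a + b) * c = a * c + b * c"
    by transfer (rule relI, auto simp: padic_rel_def distrib_right intro!: cauchy)
  show "(0::'a padic) \<noteq> 1"
    by transfer (simp add: padic_rel_def padic_null_def padic_abs_1[OF p] LIMSEQ_const_iff)
  have inv: "padic_null ?p (\<lambda>n. inverse (X n) * X n - 1)"
    if X: "padic_Cauchy ?p X" "\<not> padic_null ?p X" for X
  proof -
    obtain b k where b: "b > 0" "\<And>n. n \<ge> k \<Longrightarrow> b < padic_abs ?p (X n)"
      using padic_not_null_bounded_below[OF p X] by blast
    have "inverse (X n) * X n - 1 = 0" if "n \<ge> k" for n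
    proof -
      have "X n \<noteq> 0" using b(1) b(2)[OF that] by (intro notI) simp
      then show ?thesis by simp
    qed
    then have "eventually (\<lambda>n. padic_abs ?p (inverse (X n) * X n - 1) = 0) sequentially"
      unfolding eventually_sequentially by (metis padic_abs_0)
    then show ?thesis unfolding padic_null_def by (rule tendsto_eventually)
  qed
  show "a \<noteq> 0 \<Longrightarrow> inverse a * a = 1"
    by transfer (auto simp: padic_rel_def inv padic_Cauchy_mult padic_Cauchy_inverse p)
  show "a div b = a * inverse b"
    by (rule divide_padic_def)
  show "inverse (0::'a padic) = 0"
    by transfer (simp add: padic_rel_def padic_null_def)
qed

end

instantiation padic :: (prime_card) "{dist_norm, metric_space}"
begin

lift_definition norm_padic :: "'a padic \<Rightarrow> real" is "\<lambda>X. lim (\<lambda>n. padic_abs CARD('a) (X n))"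
proof -
  let ?p = "CARD('a)"
  have p: "prime ?p" by (rule prime_card)
  fix X Y assume XY: "padic_rel ?p X Y"
  then obtain L where L: "(\<lambda>n. padic_abs ?p (X n)) \<longlonglongrightarrow> L"
    using padic_Cauchy_convergent[OF p] unfolding padic_rel_def convergent_def by blast
  have null: "(\<lambda>n. padic_abs ?p (X n - Y n)) \<longlonglongrightarrow> 0"
    using XY unfolding padic_rel_def padic_null_def by auto
  have "(\<lambda>n. padic_abs ?p (X n) - padic_abs ?p (Y n)) \<longlonglongrightarrow> 0"
    by (rule tendsto_rabs_zero_cancel, rule tendsto_sandwich[OF _ _ tendsto_const null])
       (auto simp: padic_abs_diff_triangle[OF p])
  from tendsto_diff[OF L this] have "(\<lambda>n. padic_abs ?p (Y n)) \<longlonglongrightarrow> L" by simp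
  with L show "lim (\<lambda>n. padic_abs ?p (X n)) = lim (\<lambda>n. padic_abs ?p (Y n))"
    by (simp add: limI)
qed

definition "dist x y = norm (x - y)" for x y :: "'a padic"

definition "(uniformity :: ('a padic \<times> 'a padic) filter) =
  (INF e\<in>{0<..}. principal {(x, y). dist x y < e})"

definition "open U \<longleftrightarrow> (\<forall>x\<in>U. \<forall>\<^sub>F (x', y) in uniformity. x' = x \<longrightarrow> y \<in> U)"
  for U :: "'a padic set"

instance
proof
  let ?p = "CARD('a)"
  have p: "prime ?p" by (rule prime_card)
  have lim: "(\<lambda>n. padic_abs ?p (X n)) \<longlonglongrightarrow> lim (\<lambda>n. padic_abs ?p (X n))"
    if "padic_rel ?p X X" for X
    using that padic_Cauchy_convergent[OF p] by (simp add: padic_rel_def convergent_LIMSEQ_iff)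
  have norm_0: "norm x = 0 \<longleftrightarrow> x = 0" for x :: "'a padic"
  proof (cases x rule: padic_cases)
    case (1 X)
    have 0: "padic_rel ?p (\<lambda>n. 0) (\<lambda>n. 0)" by (simp add: padic_rel_refl)
    have "norm x = 0 \<longleftrightarrow> padic_null ?p X"
      using lim[OF 1(1)] limI[of "\<lambda>n. padic_abs ?p (X n)" 0]
      by (auto simp: 1(2) norm_padic.abs_eq[OF 1(1)] padic_null_def)
    also have "\<dots> \<longleftrightarrow> x = 0"
      using 1(1) padic_of_seq_eq_iff[OF 1(1) 0] by (simp add: 1(2) zero_padic_def padic_rel_def)
    finally show ?thesis .
  qed
  have norm_triangle: "norm (x + y) \<le> norm x + norm y" for x y :: "'a padic"
  proof (cases x rule: padic_cases, cases y rule: padic_cases)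
    fix X Y
    assume X: "padic_rel ?p X X" "x = padic_of_seq X" and Y: "padic_rel ?p Y Y" "y = padic_of_seq Y"
    then have XY: "padic_rel ?p (\<lambda>n. X n + Y n) (\<lambda>n. X n + Y n)"
      by (auto simp: padic_rel_def padic_null_def padic_Cauchy_add p)
    from lim[OF this] tendsto_add[OF lim[OF X(1)] lim[OF Y(1)]]
    have "lim (\<lambda>n. padic_abs ?p (X n + Y n))
        \<le> lim (\<lambda>n. padic_abs ?p (X n)) + lim (\<lambda>n. padic_abs ?p (Y n))"
      by (rule LIMSEQ_le) (use padic_abs_triangle[OF p] in blast)
    then show ?thesis
      by (simp add: X Y plus_padic.abs_eq norm_padic.abs_eq XY)
  qed
  have norm_minus: "norm (- x) = norm x" for x :: "'a padic"
  proof (cases x rule: padic_cases)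
    case (1 X)
    then have "padic_rel ?p (\<lambda>n. - X n) (\<lambda>n. - X n)"
      by (auto simp: padic_rel_def padic_null_def padic_Cauchy_minus)
    then show ?thesis by (simp add: 1 uminus_padic.abs_eq norm_padic.abs_eq)
  qed
  fix x y z :: "'a padic"
  show "dist x y = norm (x - y)"
    by (rule dist_padic_def)
  show "uniformity = (INF e\<in>{0<..}. principal {(x :: 'a padic, y). dist x y < e})"
    by (rule uniformity_padic_def)
  show "open U \<longleftrightarrow> (\<forall>x\<in>U. \<forall>\<^sub>F (x', y) in uniformity. x' = x \<longrightarrow> y \<in> U)" for U :: "'a padic set"
    by (rule open_padic_def)
  show "dist x y = 0 \<longleftrightarrow> x = y"
    by (simp add: dist_padic_def norm_0)
  show "dist x y \<le> dist x z + dist y z"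
    using norm_triangle[of "x - z" "- (y - z)"] norm_minus[of "y - z"] by (simp add: dist_padic_def)
qed

end


section \<open>Coordinate spaces\<close>

text \<open>\<open>K\<^sup>n\<close> is the set of all functions from the naturals to \<open>K\<close> vanishing outside \<open>{..<n}\<close>, with
  the product topology; for \<open>K = \<real>\<close> its subspace topology is \<^const>\<open>Euclidean_space\<close>. Dimension
  \<open>0\<close> is allowed.\<close>

definition coord_space :: "nat \<Rightarrow> (nat \<Rightarrow> 'k::zero) set" where
  "coord_space n = {x. \<forall>i\<ge>n. x i = 0}"

definition euclidean_dist :: "nat \<Rightarrow> (nat \<Rightarrow> real) \<Rightarrow> (nat \<Rightarrow> real) \<Rightarrow> real" where
  "euclidean_dist n x y = L2_set (\<lambda>i. x i - y i) {..<n}"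

definition max_dist :: "nat \<Rightarrow> (nat \<Rightarrow> 'k::metric_space) \<Rightarrow> (nat \<Rightarrow> 'k) \<Rightarrow> real" where
  "max_dist n x y = Max (insert 0 ((\<lambda>i. dist (x i) (y i)) ` {..<n}))"

text \<open>Scalar functions on an open subset \<open>U\<close> of \<open>\<real>\<^sup>n\<close> of class \<open>C\<^sup>k\<close>: all iterated
  partial derivatives up to order \<open>k\<close> exist and are continuous on \<open>U\<close>.\<close>

primrec C_k_on :: "nat \<Rightarrow> nat \<Rightarrow> (nat \<Rightarrow> real) set \<Rightarrow> ((nat \<Rightarrow> real) \<Rightarrow> real) \<Rightarrow> bool" where
  "C_k_on 0 n U f \<longleftrightarrow> continuous_on U f"
| "C_k_on (Suc k) n U f \<longleftrightarrow> continuous_on U f \<and>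
     (\<forall>i<n. \<exists>f'. (\<forall>x\<in>U. ((\<lambda>t. f (x(i := t))) has_real_derivative f' x) (at (x i)))
                \<and> C_k_on k n U f')"

definition smooth_real :: "nat \<Rightarrow> (nat \<Rightarrow> real) set \<Rightarrow> ((nat \<Rightarrow> real) \<Rightarrow> real) \<Rightarrow> bool" where
  "smooth_real n U f \<longleftrightarrow> (\<forall>k. C_k_on k n U f)"

text \<open>Scalar functions on an open subset \<open>U\<close> of \<open>K\<^sup>n\<close> that are locally given by convergent power
  series. The summation index \<open>\<alpha>\<close> ranges over the multi-indices of length \<open>n\<close>.\<close>

definition analytic_padic ::
  "nat \<Rightarrow> (nat \<Rightarrow> 'p::prime_card padic) set \<Rightarrow> ((nat \<Rightarrow> 'p padic) \<Rightarrow> 'p padic) \<Rightarrow> bool" where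
  "analytic_padic n U f \<longleftrightarrow>
     (\<forall>a\<in>U. \<exists>r>0. \<exists>c :: (nat \<Rightarrow> nat) \<Rightarrow> 'p padic. \<forall>x\<in>U. max_dist n x a < r \<longrightarrow>
        ((\<lambda>\<alpha>. c \<alpha> * (\<Prod>i<n. (x i - a i) ^ \<alpha> i)) has_sum f x) (coord_space n))"


section \<open>Manifolds and Lie groups\<close>

text \<open>A chart is a pair of its domain and its coordinate map. The parameter \<open>reg\<close> of the
  following definitions selects the scalar functions that are smooth (over \<open>\<real>\<close>) or analytic (over
  the p-adic numbers): \<open>reg m V g\<close> refers to \<open>g\<close> on the open subset \<open>V\<close> of \<open>K\<^sup>m\<close>.\<close>

type_synonym ('a, 'k) chart = "'a set \<times> ('a \<Rightarrow> nat \<Rightarrow> 'k)"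

type_synonym 'k regularity = "nat \<Rightarrow> (nat \<Rightarrow> 'k) set \<Rightarrow> ((nat \<Rightarrow> 'k) \<Rightarrow> 'k) \<Rightarrow> bool"

definition topological_chart ::
  "nat \<Rightarrow> 'a topology \<Rightarrow> ('a, 'k::{zero,topological_space}) chart \<Rightarrow> bool" where
  "topological_chart n T = (\<lambda>(U, \<phi>). openin T U \<and>
     openin (top_of_set (coord_space n)) (\<phi> ` U) \<and>
     homeomorphic_map (subtopology T U) (top_of_set (\<phi> ` U)) \<phi>)"

definition regular_transition ::
  "'k regularity \<Rightarrow> nat \<Rightarrow> ('a, 'k) chart \<Rightarrow> ('a, 'k) chart \<Rightarrow> bool" where
  "regular_transition reg n = (\<lambda>(U, \<phi>) (V, \<psi>).
     \<forall>j<n. reg n (\<phi> ` (U \<inter> V)) (\<lambda>z. \<psi> (inv_into U \<phi> z) j))"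

definition atlas ::
  "'k::{zero,topological_space} regularity \<Rightarrow> nat \<Rightarrow> 'a topology \<Rightarrow> ('a, 'k) chart set \<Rightarrow> bool" where
  "atlas reg n T A \<longleftrightarrow>
     (\<forall>c\<in>A. topological_chart n T c) \<and> (\<Union>(U, \<phi>)\<in>A. U) = topspace T \<and>
     (\<forall>c\<in>A. \<forall>c'\<in>A. regular_transition reg n c c')"

text \<open>The coordinate maps of the manifold given by the atlas \<open>A\<close>: the members of the maximal
  atlas containing \<open>A\<close>.\<close>

definition coordinate_map ::
  "'k::{zero,topological_space} regularity \<Rightarrow> nat \<Rightarrow> 'a topology \<Rightarrow> ('a, 'k) chart set
     \<Rightarrow> ('a, 'k) chart \<Rightarrow> bool" where
  "coordinate_map reg n T A c \<longleftrightarrow> topological_chart n T c \<and>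
     (\<forall>c'\<in>A. regular_transition reg n c c' \<and> regular_transition reg n c' c)"

text \<open>Multiplication is read in coordinates as a map on an open subset of \<open>K\<^sup>n \<times> K\<^sup>n = K\<^bsup>2n\<^esup>\<close>;
  the two functions below are the projections to the factors.\<close>

definition fst_coords :: "nat \<Rightarrow> (nat \<Rightarrow> 'k::zero) \<Rightarrow> nat \<Rightarrow> 'k" where
  "fst_coords n z = (\<lambda>i. if i < n then z i else 0)"

definition snd_coords :: "nat \<Rightarrow> (nat \<Rightarrow> 'k) \<Rightarrow> nat \<Rightarrow> 'k" where
  "snd_coords n z = (\<lambda>i. z (n + i))"

definition regular_mult ::
  "'k::zero regularity \<Rightarrow> nat \<Rightarrow> ('a, 'b) monoid_scheme \<Rightarrow> ('a, 'k) chart set \<Rightarrow> bool" where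
  "regular_mult reg n G A \<longleftrightarrow> (\<forall>(U, \<phi>)\<in>A. \<forall>(V, \<psi>)\<in>A. \<forall>(W, \<theta>)\<in>A. \<forall>j<n.
     let mult = (\<lambda>z. inv_into U \<phi> (fst_coords n z) \<otimes>\<^bsub>G\<^esub> inv_into V \<psi> (snd_coords n z)) in
     reg (2 * n)
       {z \<in> coord_space (2 * n). fst_coords n z \<in> \<phi> ` U \<and> snd_coords n z \<in> \<psi> ` V \<and> mult z \<in> W}
       (\<lambda>z. \<theta> (mult z) j))"

definition regular_inv ::
  "'k regularity \<Rightarrow> nat \<Rightarrow> ('a, 'b) monoid_scheme \<Rightarrow> ('a, 'k) chart set \<Rightarrow> bool" where
  "regular_inv reg n G A \<longleftrightarrow> (\<forall>(U, \<phi>)\<in>A. \<forall>(V, \<psi>)\<in>A. \<forall>j<n.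
     reg n (\<phi> ` {x \<in> U. inv\<^bsub>G\<^esub> x \<in> V}) (\<lambda>z. \<psi> (inv\<^bsub>G\<^esub> (inv_into U \<phi> z)) j))"

text \<open>A group manifold of dimension \<open>n\<close> whose group operations are regular. Second countability
  is not listed, because it is automatic in the compact case.\<close>

definition lie_group ::
  "'k::{zero,topological_space} regularity \<Rightarrow> nat \<Rightarrow> ('a, 'b) monoid_scheme \<Rightarrow> 'a topology
     \<Rightarrow> ('a, 'k) chart set \<Rightarrow> bool" where
  "lie_group reg n G T A \<longleftrightarrow>
     group G \<and> topspace T = carrier G \<and> Hausdorff_space T \<and> atlas reg n T A \<and>
     continuous_map (prod_topology T T) T (\<lambda>(x, y). x \<otimes>\<^bsub>G\<^esub> y) \<and>
     continuous_map T T (\<lambda>x. inv\<^bsub>G\<^esub> x) \<and>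
     regular_mult reg n G A \<and> regular_inv reg n G A"

text \<open>A \<open>reg\<close>-compatible metric, where \<open>D\<close> is the metric on \<open>K\<^sup>n\<close>. Neighbourhoods are taken in
  the topology \<open>T\<close> of the Lie group.\<close>

definition compatible_metric ::
  "'k::{zero,topological_space} regularity \<Rightarrow> ((nat \<Rightarrow> 'k) \<Rightarrow> (nat \<Rightarrow> 'k) \<Rightarrow> real) \<Rightarrow> nat
     \<Rightarrow> ('a, 'b) monoid_scheme \<Rightarrow> 'a topology \<Rightarrow> ('a, 'k) chart set \<Rightarrow> ('a \<Rightarrow> 'a \<Rightarrow> real) \<Rightarrow> bool" where
  "compatible_metric reg D n G T A d \<longleftrightarrow>
     Metric_space (carrier G) d \<and>
     (\<forall>g\<in>carrier G. \<forall>x\<in>carrier G. \<forall>y\<in>carrier G.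
        d (g \<otimes>\<^bsub>G\<^esub> x) (g \<otimes>\<^bsub>G\<^esub> y) = d x y \<and> d (x \<otimes>\<^bsub>G\<^esub> g) (y \<otimes>\<^bsub>G\<^esub> g) = d x y) \<and>
     (\<exists>U \<phi> W L. coordinate_map reg n T A (U, \<phi>) \<and> openin T W \<and> \<one>\<^bsub>G\<^esub> \<in> W \<and> W \<subseteq> U \<and> L > 0 \<and>
        (\<forall>x\<in>W. \<forall>y\<in>W. D (\<phi> x) (\<phi> y) \<le> L * d x y \<and> d x y \<le> L * D (\<phi> x) (\<phi> y)))"

definition compact_real_lie_group ::
  "nat \<Rightarrow> ('a, 'b) monoid_scheme \<Rightarrow> 'a topology \<Rightarrow> ('a, real) chart set \<Rightarrow> bool" where
  "compact_real_lie_group n G T A \<longleftrightarrow> lie_group smooth_real n G T A \<and> compact_space T"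

definition compact_padic_lie_group ::
  "nat \<Rightarrow> ('a, 'b) monoid_scheme \<Rightarrow> 'a topology \<Rightarrow> ('a, 'p::prime_card padic) chart set \<Rightarrow> bool" where
  "compact_padic_lie_group n G T A \<longleftrightarrow> lie_group analytic_padic n G T A \<and> compact_space T"

definition real_compatible_metric ::
  "nat \<Rightarrow> ('a, 'b) monoid_scheme \<Rightarrow> 'a topology \<Rightarrow> ('a, real) chart set \<Rightarrow> ('a \<Rightarrow> 'a \<Rightarrow> real) \<Rightarrow> bool" where
  "real_compatible_metric n = compatible_metric smooth_real (euclidean_dist n) n"

definition padic_compatible_metric ::
  "nat \<Rightarrow> ('a, 'b) monoid_scheme \<Rightarrow> 'a topology \<Rightarrow> ('a, 'p::prime_card padic) chart set
     \<Rightarrow> ('a \<Rightarrow> 'a \<Rightarrow> real) \<Rightarrow> bool" where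
  "padic_compatible_metric n = compatible_metric analytic_padic (max_dist n) n"


section \<open>Upper Minkowski dimension\<close>

text \<open>The balls are those of the subspace \<open>X\<close>: \<^const>\<open>Metric_space.mball\<close> is used with carrier \<open>X\<close>.
  The packing number is infinite if arbitrarily large finite packings exist.\<close>

definition packing_number :: "'a set \<Rightarrow> ('a \<Rightarrow> 'a \<Rightarrow> real) \<Rightarrow> real \<Rightarrow> enat" where
  "packing_number X d \<delta> =
     Sup {enat (card \<B>) | \<B>. finite \<B> \<and> \<B> \<subseteq> (\<lambda>x. Metric_space.mball X d x \<delta>) ` X \<and> pairwise disjnt \<B>}"

definition upper_minkowski_dim :: "'a set \<Rightarrow> ('a \<Rightarrow> 'a \<Rightarrow> real) \<Rightarrow> ereal" where
  "upper_minkowski_dim X d =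
     Limsup (at_right 0) (\<lambda>\<delta>. case packing_number X d \<delta> of
        enat N \<Rightarrow> ereal (- ln (real N) / ln \<delta>) | \<infinity> \<Rightarrow> \<infinity>)"

end

theory Submission
  imports Defs
begin

text \<open>The argument compares the packing numbers of \<open>X\<close> and \<open>Y\<close> with the size of a fine net in a
  chart.

  If a packing of \<open>X\<close> by \<open>\<delta>\<close>-balls has the largest possible number of members, then every point of
  \<open>X\<close> lies within \<open>2\<delta>\<close> of one of the centres, for otherwise another ball could be added; likewise
  for \<open>Y\<close>. By bi-invariance \<open>d (x y) (x' y') \<le> d x x' + d y y'\<close>, so the products of centres are a
  \<open>4\<delta>\<close>-net of \<open>XY = G\<close>. Two distinct points of a set with mutual distances at least \<open>8\<delta>\<close> cannot be within
  \<open>4\<delta>\<close> of the same product, hence such a set has at most \<open>N\<^sub>\<delta>(X) N\<^sub>\<delta>(Y)\<close> elements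
  (\<open>separated_card_le_packing_numbers\<close>).

  On the other hand the image of a chart contains a box of \<open>K\<^sup>n\<close>, and in each coordinate an arithmetic
  progression (over the reals) or its multiple by a power of \<open>p\<close> (over the p-adic numbers) has a
  constant times \<open>1/s\<close> points with distances at least \<open>s\<close>. Since the chart distorts distances by a
  bounded factor, \<open>G\<close> contains a constant times \<open>s\<^sup>-\<^sup>n\<close> points with mutual distances at least \<open>s\<close>
  (\<open>compatible_metric_separated\<close>). Therefore \<open>N\<^sub>\<delta>(X) N\<^sub>\<delta>(Y) \<ge> c \<delta>\<^sup>-\<^sup>n\<close> with \<open>c\<close> independent of \<open>\<delta>\<close>, and the claim
  follows on taking logarithms, because the upper limit is subadditive
  (\<open>upper_minkowski_dim_sum_ge\<close>).\<close>

section \<open>Packing numbers\<close>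

definition separated_by :: "('a \<Rightarrow> 'a \<Rightarrow> real) \<Rightarrow> real \<Rightarrow> 'a set \<Rightarrow> bool" where
  "separated_by d s S \<longleftrightarrow> (\<forall>x\<in>S. \<forall>y\<in>S. x \<noteq> y \<longrightarrow> s \<le> d x y)"

lemma separated_by_image:
  assumes "\<And>i j. i \<in> I \<Longrightarrow> j \<in> I \<Longrightarrow> i \<noteq> j \<Longrightarrow> s \<le> d (f i) (f j)"
  shows "separated_by d s (f ` I)"
  unfolding separated_by_def
proof (intro ballI impI)
  fix x y assume "x \<in> f ` I" "y \<in> f ` I" "x \<noteq> y"
  then obtain i j where "i \<in> I" "j \<in> I" "x = f i" "y = f j" "i \<noteq> j"
    by auto
  with assms[of i j] show "s \<le> d x y"
    by simp
qed

text \<open>A finite supremum of extended naturals is a maximum; this turns the packing number into an actual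
  packing.\<close>

lemma (in Metric_space) packing_number_attained:
  assumes fin: "packing_number M d \<delta> = enat N"
  obtains \<B> where "finite \<B>" "\<B> \<subseteq> (\<lambda>x. mball x \<delta>) ` M" "pairwise disjnt \<B>" "card \<B> = N"
proof -
  define P where "P = {enat (card \<B>) | \<B>. finite \<B> \<and> \<B> \<subseteq> (\<lambda>x. mball x \<delta>) ` M \<and> pairwise disjnt \<B>}"
  have eq: "Sup P = enat N"
    using fin by (simp add: packing_number_def P_def)
  have "enat (card {}) \<in> P"
    unfolding P_def by (intro CollectI exI[of _ "{}"]) auto
  then have ne: "P \<noteq> {}"
    by blast
  with eq have "finite P" "Max P = enat N"
    by (auto simp: Sup_enat_def split: if_splits)
  with ne have "enat N \<in> P"
    using Max_in by metis
  then show ?thesis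
    using that by (auto simp: P_def)
qed

lemma (in Metric_space) card_le_packing_number:
  assumes "finite \<B>" "\<B> \<subseteq> (\<lambda>x. mball x \<delta>) ` M" "pairwise disjnt \<B>"
  shows "enat (card \<B>) \<le> packing_number M d \<delta>"
  unfolding packing_number_def by (intro Sup_upper) (use assms in blast)

lemma (in Metric_space) one_le_packing_number:
  assumes "M \<noteq> {}"
  shows "1 \<le> packing_number M d \<delta>"
proof -
  obtain x where "x \<in> M"
    using assms by blast
  then show ?thesis
    using card_le_packing_number[of "{mball x \<delta>}" \<delta>] by (simp add: one_enat_def pairwise_def)
qed

text \<open>The centres of a largest packing: a ball about a point at distance at least \<open>2\<delta>\<close> from all of them
  would be disjoint from every member and could be added.\<close>

lemma (in Metric_space) packing_number_covers:
  assumes fin: "packing_number M d \<delta> = enat N" and \<delta>: "\<delta> > 0"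
  obtains C where "finite C" "C \<subseteq> M" "card C \<le> N" "\<And>x. x \<in> M \<Longrightarrow> \<exists>c\<in>C. d x c < 2 * \<delta>"
proof -
  obtain \<B> where \<B>: "finite \<B>" "\<B> \<subseteq> (\<lambda>x. mball x \<delta>) ` M" "pairwise disjnt \<B>" "card \<B> = N"
    using packing_number_attained[OF fin] by blast
  obtain C where C: "finite C" "C \<subseteq> M" "\<B> = (\<lambda>x. mball x \<delta>) ` C" "card C = card \<B>"
    using \<B>(1,2) by (metis card_image finite_subset_image subset_image_inj finite_imageD)
  have "\<exists>c\<in>C. d x c < 2 * \<delta>" if x: "x \<in> M" for x
  proof (rule ccontr)
    assume far: "\<not> (\<exists>c\<in>C. d x c < 2 * \<delta>)"
    have disj: "disjnt (mball x \<delta>) B" if B: "B \<in> \<B>" for B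
    proof (rule ccontr)
      assume "\<not> disjnt (mball x \<delta>) B"
      moreover obtain c where "c \<in> C" "B = mball c \<delta>"
        using B C(3) by blast
      ultimately obtain c y where c: "c \<in> C" and y: "y \<in> M" "d x y < \<delta>" "d c y < \<delta>"
        by (auto simp: disjnt_iff)
      then have "d x c < 2 * \<delta>"
        using triangle[of x y c] commute[of c y] x C(2) by auto
      with far c show False
        by blast
    qed
    \<comment> \<open>Packings are counted as sets of balls, so the added ball must differ from the old ones as a
      set; it does, being nonempty and disjoint from them.\<close>
    have "x \<in> mball x \<delta>"
      using x \<delta> by simp
    then have new: "mball x \<delta> \<notin> \<B>"
      using disj by (metis disjnt_iff)
    have "pairwise disjnt (insert (mball x \<delta>) \<B>)"
      using \<B>(3) disj by (auto simp: pairwise_insert disjnt_sym)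
    then have "enat (card (insert (mball x \<delta>) \<B>)) \<le> enat N"
      using card_le_packing_number[of "insert (mball x \<delta>) \<B>" \<delta>] \<B>(1,2) x fin by auto
    with new \<B> show False
      by simp
  qed
  with C \<B>(4) that show ?thesis
    by auto
qed

text \<open>Send each point of \<open>S\<close> to a pair of centres whose product is within \<open>4\<delta>\<close> of it. The separation
  makes this map injective. Left and right invariance are each used for one of the two factors.\<close>

lemma separated_card_le_packing_numbers:
  fixes G :: "('a, 'b) monoid_scheme"
  assumes G: "group G" and M: "Metric_space (carrier G) d"
    and inv: "\<And>g x y. g \<in> carrier G \<Longrightarrow> x \<in> carrier G \<Longrightarrow> y \<in> carrier G \<Longrightarrow>
      d (g \<otimes>\<^bsub>G\<^esub> x) (g \<otimes>\<^bsub>G\<^esub> y) = d x y \<and> d (x \<otimes>\<^bsub>G\<^esub> g) (y \<otimes>\<^bsub>G\<^esub> g) = d x y"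
    and X: "X \<subseteq> carrier G" and Y: "Y \<subseteq> carrier G" and XY: "X <#>\<^bsub>G\<^esub> Y = carrier G"
    and \<delta>: "\<delta> > 0"
    and NX: "packing_number X d \<delta> = enat NX" and NY: "packing_number Y d \<delta> = enat NY"
    and S: "S \<subseteq> carrier G" "separated_by d (8 * \<delta>) S"
  shows "card S \<le> NX * NY"
proof -
  interpret group G by (rule G)
  interpret Metric_space "carrier G" d by (rule M)
  obtain C where C: "finite C" "C \<subseteq> X" "card C \<le> NX" "\<And>x. x \<in> X \<Longrightarrow> \<exists>c\<in>C. d x c < 2 * \<delta>"
    using Metric_space.packing_number_covers[OF subspace[OF X] NX \<delta>] by blast
  obtain D where D: "finite D" "D \<subseteq> Y" "card D \<le> NY" "\<And>y. y \<in> Y \<Longrightarrow> \<exists>c\<in>D. d y c < 2 * \<delta>"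
    using Metric_space.packing_number_covers[OF subspace[OF Y] NY \<delta>] by blast
  have "\<exists>q\<in>C \<times> D. d g (fst q \<otimes>\<^bsub>G\<^esub> snd q) < 4 * \<delta>" if g: "g \<in> carrier G" for g
  proof -
    obtain x y where xy: "x \<in> X" "y \<in> Y" "g = x \<otimes>\<^bsub>G\<^esub> y"
      using g XY unfolding set_mult_def by blast
    obtain c e where ce: "c \<in> C" "e \<in> D" "d x c < 2 * \<delta>" "d y e < 2 * \<delta>"
      using C(4) D(4) xy by metis
    have mem: "x \<in> carrier G" "y \<in> carrier G" "c \<in> carrier G" "e \<in> carrier G"
      using xy ce X Y C D by auto
    have "d g (c \<otimes>\<^bsub>G\<^esub> e) \<le> d (x \<otimes>\<^bsub>G\<^esub> y) (c \<otimes>\<^bsub>G\<^esub> y) + d (c \<otimes>\<^bsub>G\<^esub> y) (c \<otimes>\<^bsub>G\<^esub> e)"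
      unfolding xy(3) by (rule triangle) (use mem in auto)
    also have "\<dots> = d x c + d y e"
      using inv mem by simp
    finally show ?thesis
      using ce by (intro bexI[of _ "(c, e)"]) auto
  qed
  then obtain q where q: "\<And>g. g \<in> carrier G \<Longrightarrow> q g \<in> C \<times> D"
      "\<And>g. g \<in> carrier G \<Longrightarrow> d g (fst (q g) \<otimes>\<^bsub>G\<^esub> snd (q g)) < 4 * \<delta>"
    by metis
  have "inj_on q S"
  proof (rule inj_onI, rule ccontr)
    fix g h assume gh: "g \<in> S" "h \<in> S" "q g = q h" "g \<noteq> h"
    define z where "z = fst (q g) \<otimes>\<^bsub>G\<^esub> snd (q g)"
    have mem: "g \<in> carrier G" "h \<in> carrier G"
      using gh S(1) by auto
    then have "fst (q g) \<in> carrier G" "snd (q g) \<in> carrier G"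
      using q(1)[of g] C(2) D(2) X Y by auto
    then have "z \<in> carrier G"
      by (simp add: z_def)
    moreover have "d g z < 4 * \<delta>" "d h z < 4 * \<delta>"
      using q(2)[OF mem(1)] q(2)[OF mem(2)] unfolding z_def gh(3) by blast+
    ultimately have "d g h < 8 * \<delta>"
      using triangle[of g z h] commute[of z h] mem by auto
    with S(2) gh show False
      unfolding separated_by_def by force
  qed
  moreover have "q ` S \<subseteq> C \<times> D"
    using q(1) S(1) by blast
  ultimately have "card S \<le> card (C \<times> D)"
    using C(1) D(1) by (intro card_inj_on_le[of q]) auto
  also have "\<dots> \<le> NX * NY"
    using C(3) D(3) by (simp add: card_cartesian_product mult_le_mono)
  finally show ?thesis .
qed

section \<open>Upper Minkowski dimension from packing numbers\<close>

text \<open>Subadditivity of the upper limit combined with a convergent minorant. Nonnegativity keeps the sum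
  away from \<open>\<infinity> - \<infinity>\<close>.\<close>

lemma le_Limsup_add_ereal:
  fixes f g :: "'a \<Rightarrow> ereal"
  assumes F: "F \<noteq> bot" and h: "(h \<longlongrightarrow> c) F"
    and nonneg: "eventually (\<lambda>x. 0 \<le> f x) F" "eventually (\<lambda>x. 0 \<le> g x) F"
    and le: "eventually (\<lambda>x. ereal (h x) \<le> f x + g x) F"
  shows "ereal c \<le> Limsup F f + Limsup F g"
proof (rule ccontr)
  assume "\<not> ?thesis"
  then have lt: "Limsup F f + Limsup F g < ereal c"
    by simp
  have "0 \<le> Limsup F f" "0 \<le> Limsup F g"
    using nonneg F by (auto intro!: le_Limsup)
  with lt obtain a b where a: "Limsup F f = ereal a" and b: "Limsup F g = ereal b"
    by (cases "Limsup F f"; cases "Limsup F g") auto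
  define e where "e = (c - a - b) / 3"
  have e: "e > 0"
    using lt a b by (simp add: e_def)
  have "eventually (\<lambda>x. f x < ereal (a + e)) F"
    using e a by (intro Limsup_lessD) auto
  moreover have "eventually (\<lambda>x. g x < ereal (b + e)) F"
    using e b by (intro Limsup_lessD) auto
  moreover have "eventually (\<lambda>x. c - e < h x) F"
    using e by (intro order_tendstoD(1)[OF h]) simp
  ultimately have "eventually (\<lambda>x. False) F"
    using le
  proof eventually_elim
    case (elim x)
    have "f x + g x < ereal (a + e) + ereal (b + e)"
      using elim by (intro ereal_add_strict_mono2)
    also have "\<dots> = ereal (c - e)"
      by (simp add: e_def field_simps)
    also have "\<dots> < ereal (h x)"
      using elim by simp
    finally show ?case
      using elim by simp
  qed
  with F show False
    by simp
qed

text \<open>For \<open>\<delta> < 1\<close>, taking logarithms in the bound and dividing by \<open>- ln \<delta> > 0\<close> gives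
  \<open>n - ln K / ln \<delta>\<close> as a minorant, and the constant disappears in the limit. At a
  scale with an infinite packing number the sum is \<open>\<infinity>\<close>.\<close>

lemma upper_minkowski_dim_sum_ge:
  assumes "Metric_space X d" "Metric_space Y d" "X \<noteq> {}" "Y \<noteq> {}" and K: "K > 0"
    and bound: "\<And>\<delta> NX NY. \<delta> > 0 \<Longrightarrow> packing_number X d \<delta> = enat NX \<Longrightarrow>
      packing_number Y d \<delta> = enat NY \<Longrightarrow> K / \<delta> ^ n \<le> real (NX * NY)"
  shows "ereal (real n) \<le> upper_minkowski_dim X d + upper_minkowski_dim Y d"
proof -
  \<comment> \<open>The function whose upper limit is the dimension of \<open>Z\<close>.\<close>
  define \<phi> where "\<phi> Z = (\<lambda>\<delta>. case packing_number Z d \<delta> of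
     enat N \<Rightarrow> ereal (- ln (real N) / ln \<delta>) | \<infinity> \<Rightarrow> \<infinity>)" for Z
  have small: "eventually (\<lambda>\<delta>::real. 0 < \<delta> \<and> \<delta> < 1) (at_right 0)"
    using eventually_at_right_real[of 0 1] by simp
  have nonneg: "0 \<le> \<phi> Z \<delta>" if Z: "Metric_space Z d" "Z \<noteq> {}" and \<delta>: "0 < \<delta> \<and> \<delta> < 1" for Z \<delta>
  proof (cases "packing_number Z d \<delta>")
    case (enat N)
    then have "1 \<le> N"
      using Metric_space.one_le_packing_number[OF Z, of \<delta>] by (simp add: one_enat_def)
    with \<delta> enat show ?thesis
      by (simp add: \<phi>_def divide_nonneg_neg divide_nonpos_neg)
  qed (simp add: \<phi>_def)
  have h: "((\<lambda>\<delta>. real n - ln K / ln \<delta>) \<longlongrightarrow> real n) (at_right 0)"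
  proof -
    have "((\<lambda>\<delta>. ln K / ln \<delta>) \<longlongrightarrow> 0) (at_right 0)"
      using tendsto_divide_0[OF tendsto_const filterlim_at_bot_imp_at_infinity[OF ln_at_0]] .
    then show ?thesis
      using tendsto_diff[OF tendsto_const[of "real n"]] by fastforce
  qed
  have le: "ereal (real n - ln K / ln \<delta>) \<le> \<phi> X \<delta> + \<phi> Y \<delta>" if \<delta>: "0 < \<delta> \<and> \<delta> < 1" for \<delta>
  proof (cases "packing_number X d \<delta> = \<infinity> \<or> packing_number Y d \<delta> = \<infinity>")
    case True
    then have "\<phi> X \<delta> = \<infinity> \<or> \<phi> Y \<delta> = \<infinity>"
      by (auto simp: \<phi>_def)
    then show ?thesis
      by auto
  next
    case False
    then obtain NX NY where N: "packing_number X d \<delta> = enat NX" "packing_number Y d \<delta> = enat NY"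
      by auto
    have pos: "1 \<le> NX" "1 \<le> NY"
      using Metric_space.one_le_packing_number[OF assms(1,3), of \<delta>]
        Metric_space.one_le_packing_number[OF assms(2,4), of \<delta>] N by (simp_all add: one_enat_def)
    have ln: "ln \<delta> < 0"
      using \<delta> by simp
    have "ln (K / \<delta> ^ n) \<le> ln (real (NX * NY))"
      using bound[OF _ N] \<delta> K pos by (intro ln_mono) auto
    then have "ln K - real n * ln \<delta> \<le> ln (real NX) + ln (real NY)"
      using K \<delta> pos by (simp add: ln_div ln_mult ln_realpow)
    then have "(ln (real NX) + ln (real NY)) / ln \<delta> \<le> (ln K - real n * ln \<delta>) / ln \<delta>"
      using ln by (intro divide_right_mono_neg) auto
    also have "\<dots> = ln K / ln \<delta> - real n"
      using ln by (simp add: diff_divide_distrib)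
    finally show ?thesis
      by (simp add: \<phi>_def N add_divide_distrib)
  qed
  have "ereal (real n) \<le> Limsup (at_right 0) (\<phi> X) + Limsup (at_right 0) (\<phi> Y)"
    by (rule le_Limsup_add_ereal[OF _ h])
       (use small nonneg[OF assms(1,3)] nonneg[OF assms(2,4)] le in \<open>auto elim: eventually_mono\<close>)
  then show ?thesis
    unfolding upper_minkowski_dim_def \<phi>_def .
qed

section \<open>Separated sets in coordinate spaces\<close>

text \<open>What the real and the p-adic line have in common: every ball has lower Minkowski dimension at least
  one, with a bound that is uniform in the scale \<open>s\<close>. The constant may depend on the ball.\<close>

definition linearly_packed :: "'k::metric_space itself \<Rightarrow> bool" where
  "linearly_packed _ \<longleftrightarrow> (\<forall>(a::'k) e. e > 0 \<longrightarrow> (\<exists>c>0. \<forall>s>0. \<exists>F. finite F \<and> F \<subseteq> ball a e \<and>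
     separated_by dist s F \<and> c / s \<le> real (card F)))"

text \<open>The progression \<open>a, a + s, a + 2s, \<dots>\<close> stays in the ball for the first \<open>\<lceil>e / s\<rceil>\<close> terms.\<close>

lemma linearly_packed_real: "linearly_packed TYPE(real)"
  unfolding linearly_packed_def
proof (intro allI impI)
  fix a e :: real assume e: "e > 0"
  have "\<exists>F. finite F \<and> F \<subseteq> ball a e \<and> separated_by dist s F \<and> e / s \<le> real (card F)" if s: "s > 0" for s
  proof -
    define m where "m = nat \<lceil>e / s\<rceil>"
    define f where "f k = a + s * real k" for k
    have "\<bar>f i - f j\<bar> = s * \<bar>real i - real j\<bar>" for i j
      using s by (simp add: f_def abs_mult flip: right_diff_distrib)
    moreover have "1 \<le> \<bar>real i - real j\<bar>" if "i \<noteq> j" for i j :: nat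
      using that by linarith
    ultimately have sep: "s \<le> dist (f i) (f j)" if "i \<noteq> j" for i j
      using s that by (simp add: dist_real_def)
    have inj: "inj f"
      using s by (auto simp: inj_def f_def)
    have "separated_by dist s (f ` {..<m})"
      using sep by (intro separated_by_image)
    moreover
    have "f k \<in> ball a e" if "k < m" for k
    proof -
      have "real k < e / s"
        using that unfolding m_def by linarith
      then show ?thesis
        using s by (simp add: f_def dist_real_def field_simps)
    qed
    moreover have "e / s \<le> real m"
      unfolding m_def by linarith
    moreover have "card (f ` {..<m}) = m"
      using inj by (simp add: card_image inj_on_subset)
    ultimately show ?thesis
      by (intro exI[of _ "f ` {..<m}"]) auto
  qed
  with e show "\<exists>c>0. \<forall>s>0. \<exists>F. finite F \<and> F \<subseteq> ball a e \<and> separated_by dist s F \<and> c / s \<le> real (card F)"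
    by blast
qed

definition padic_of_rat :: "rat \<Rightarrow> 'p::prime_card padic" where
  "padic_of_rat x = padic_of_seq (\<lambda>_. x)"

lemma dist_padic_of_rat:
  "dist (a + padic_of_rat x) (a + padic_of_rat y) = padic_abs CARD('p) (x - y)"
  for a :: "'p::prime_card padic"
proof -
  have rel: "padic_rel CARD('p) (\<lambda>_. z) (\<lambda>_. z)" for z
    by (simp add: padic_rel_refl)
  have minus: "- (padic_of_rat y :: 'p padic) = padic_of_rat (- y)"
    unfolding padic_of_rat_def by (rule uminus_padic.abs_eq[OF rel])
  have add: "(padic_of_rat x :: 'p padic) + padic_of_rat z = padic_of_rat (x + z)" for z
    unfolding padic_of_rat_def by (rule plus_padic.abs_eq[OF rel rel])
  have diff: "(a + padic_of_rat x) - (a + padic_of_rat y) = padic_of_rat (x - y)"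
    using add[of "- y"] unfolding minus[symmetric] by simp
  show ?thesis
    unfolding dist_padic_def diff unfolding padic_of_rat_def norm_padic.abs_eq[OF rel] by simp
qed

text \<open>The lower bound holds because the power of \<open>p\<close> dividing \<open>j\<close> is at most \<open>\<bar>j\<bar>\<close>. It is what makes the
  first \<open>K\<close> natural numbers \<open>1/K\<close>-separated in the p-adic metric.\<close>

lemma padic_abs_of_int_bounds:
  assumes p: "prime p" and j: "j \<noteq> 0"
  shows "1 / real_of_int \<bar>j\<bar> \<le> padic_abs p (of_int j)" and "padic_abs p (of_int j) \<le> 1"
proof -
  let ?m = "multiplicity (int p) j"
  have p0: "real p > 0" "real p \<ge> 1"
    using prime_gt_0_nat[OF p] prime_ge_1_nat[OF p] by auto
  have eq: "padic_abs p (of_int j) = 1 / real p ^ ?m"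
    using padic_abs_Fract[OF p j, of 1] by (simp add: power_int_minus divide_inverse)
  have "int p ^ ?m dvd \<bar>j\<bar>"
    by (simp add: multiplicity_dvd)
  then have "int p ^ ?m \<le> \<bar>j\<bar>"
    using j by (intro zdvd_imp_le) auto
  then have "real_of_int (int p ^ ?m) \<le> real_of_int \<bar>j\<bar>"
    by (simp only: of_int_le_iff)
  then have "real p ^ ?m \<le> real_of_int \<bar>j\<bar>"
    by simp
  with p0 show "1 / real_of_int \<bar>j\<bar> \<le> padic_abs p (of_int j)"
    unfolding eq using j by (intro divide_left_mono mult_pos_pos) auto
  show "padic_abs p (of_int j) \<le> 1"
    unfolding eq using p0 by (simp add: one_le_power)
qed

text \<open>Choose \<open>m\<close> with \<open>p\<^sup>-\<^sup>m < e\<close>. The points \<open>a + p\<^sup>m k\<close> all lie in the ball, and for \<open>k < K\<close> they have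
  distances at least \<open>p\<^sup>-\<^sup>m / (K - 1)\<close>, which is at least \<open>s\<close> for \<open>K = \<lceil>p\<^sup>-\<^sup>m / s\<rceil>\<close>.\<close>

lemma linearly_packed_padic: "linearly_packed TYPE('p::prime_card padic)"
  unfolding linearly_packed_def
proof (intro allI impI)
  fix a :: "'p padic" and e :: real assume e: "e > 0"
  let ?p = "CARD('p)"
  have p: "prime ?p"
    by (rule prime_card)
  have p1: "real ?p > 1"
    using prime_gt_1_nat[OF p] by simp
  obtain m where m: "(1 / real ?p) ^ m < e"
    using real_arch_pow_inv[OF e, of "1 / real ?p"] p1 by auto
  define r where "r = (1 / real ?p) ^ m"
  have r: "r > 0" "r < e"
    using m p1 by (auto simp: r_def)
  have abs_pm: "padic_abs ?p (of_nat ?p ^ m * of_int j) = r * padic_abs ?p (of_int j)" for j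
  proof -
    have "padic_abs ?p (of_nat ?p ^ m) = r"
      unfolding r_def by (induction m) (auto simp: padic_abs_1 padic_abs_mult padic_abs_prime p)
    then show ?thesis
      by (simp add: padic_abs_mult[OF p])
  qed
  have "\<exists>F. finite F \<and> F \<subseteq> ball a e \<and> separated_by dist s F \<and> r / s \<le> real (card F)" if s: "s > 0" for s
  proof -
    define K where "K = nat \<lceil>r / s\<rceil>"
    define f where "f k = a + padic_of_rat (of_nat ?p ^ m * of_int (int k))" for k
    have dist_f: "dist (f i) (f j) = r * padic_abs ?p (of_int (int i - int j))" for i j
      unfolding f_def dist_padic_of_rat abs_pm[symmetric] by (simp add: algebra_simps)
    have sep: "s \<le> dist (f i) (f j)" if "i < K" "j < K" "i \<noteq> j" for i j
    proof -
      have "real_of_int \<bar>int i - int j\<bar> \<le> r / s"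
        using that unfolding K_def by linarith
      then have "s \<le> r * (1 / real_of_int \<bar>int i - int j\<bar>)"
        using that s by (simp add: field_simps)
      also have "\<dots> \<le> dist (f i) (f j)"
        unfolding dist_f using r that by (intro mult_left_mono padic_abs_of_int_bounds p) auto
      finally show ?thesis .
    qed
    have inj: "inj_on f {..<K}"
    proof (rule inj_onI, rule ccontr)
      fix i j assume "i \<in> {..<K}" "j \<in> {..<K}" "f i = f j" "i \<noteq> j"
      with sep[of i j] s show False
        by simp
    qed
    have "f k \<in> ball a e" for k
    proof -
      have "padic_of_rat 0 = (0 :: 'p padic)"
        by (simp add: padic_of_rat_def zero_padic_def)
      then have "dist a (f k) = dist (f 0) (f k)"
        by (simp add: f_def)
      also have "\<dots> \<le> r * 1"
        unfolding dist_f using r padic_abs_of_int_bounds(2)[OF p, of "int 0 - int k"]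
        by (intro mult_left_mono) (cases "k = 0", auto)
      finally show ?thesis
        using r by simp
    qed
    moreover have "r / s \<le> real K"
      unfolding K_def by linarith
    moreover have "card (f ` {..<K}) = K"
      using inj by (simp add: card_image)
    moreover have "separated_by dist s (f ` {..<K})"
      using sep by (intro separated_by_image) auto
    ultimately show ?thesis
      by (intro exI[of _ "f ` {..<K}"]) auto
  qed
  with r show "\<exists>c>0. \<forall>s>0. \<exists>F. finite F \<and> F \<subseteq> ball a e \<and> separated_by dist s F \<and> c / s \<le> real (card F)"
    by blast
qed

text \<open>All points of the coordinate space, \<open>a\<close> included, vanish at the coordinates from \<open>n\<close> on, so only
  the first \<open>n\<close> sides of a basic neighbourhood of \<open>a\<close> constrain the radius.\<close>

lemma open_coord_space_contains_box:
  fixes V :: "(nat \<Rightarrow> 'k::{zero,metric_space}) set"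
  assumes V: "openin (top_of_set (coord_space n)) V" and a: "a \<in> V"
  obtains e where "e > 0" "\<And>z. z \<in> coord_space n \<Longrightarrow> (\<And>i. i < n \<Longrightarrow> z i \<in> ball (a i) e) \<Longrightarrow> z \<in> V"
proof -
  obtain O' where O: "open O'" "V = coord_space n \<inter> O'"
    using V by (auto simp: openin_open)
  then have "openin (product_topology (\<lambda>i. euclidean) UNIV) O'"
    by (simp add: open_fun_def)
  then obtain Z where Z: "a \<in> (\<Pi>\<^sub>E i\<in>UNIV. Z i)" "\<And>i. open (Z i)" "(\<Pi>\<^sub>E i\<in>UNIV. Z i) \<subseteq> O'"
    using product_topology_open_contains_basis[of "\<lambda>i. euclidean" UNIV O' a] a O by auto
  have "\<exists>\<epsilon>. \<forall>i. \<epsilon> i > 0 \<and> ball (a i) (\<epsilon> i) \<subseteq> Z i"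
    using Z(1,2) by (intro choice) (auto simp: PiE_iff open_contains_ball)
  then obtain \<epsilon> where \<epsilon>: "\<And>i. \<epsilon> i > 0" "\<And>i. ball (a i) (\<epsilon> i) \<subseteq> Z i"
    by blast
  \<comment> \<open>The element \<open>1\<close> makes the minimum positive when \<open>n = 0\<close>.\<close>
  define e where "e = Min (insert 1 (\<epsilon> ` {..<n}))"
  have "e > 0"
    using \<epsilon>(1) by (auto simp: e_def)
  moreover have "z \<in> V" if z: "z \<in> coord_space n" "\<And>i. i < n \<Longrightarrow> z i \<in> ball (a i) e" for z
  proof -
    have "z i \<in> Z i" for i
    proof (cases "i < n")
      case True
      then have "e \<le> \<epsilon> i"
        by (simp add: e_def)
      with z(2)[OF True] \<epsilon>(2)[of i] show ?thesis
        by auto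
    next
      case False
      then have "z i = a i"
        using z(1) a O(2) by (auto simp: coord_space_def)
      with Z(1) show ?thesis
        by (auto simp: PiE_iff)
    qed
    then show ?thesis
      using z(1) Z(3) O(2) by (auto simp: PiE_iff)
  qed
  ultimately show ?thesis
    using that by blast
qed

text \<open>Grids in the coordinate space vanish beyond \<open>n\<close>, whereas the elements of an extensional product are
  \<open>undefined\<close> there; the count is transferred between the two.\<close>

lemma finite_card_zero_extended:
  fixes F :: "nat \<Rightarrow> 'k::zero set" and n :: nat
  assumes fin: "\<And>i. finite (F i)"
  defines "S \<equiv> {z. (\<forall>i<n. z i \<in> F i) \<and> (\<forall>i\<ge>n. z i = 0)}"
  shows "finite S" and "card S = (\<Prod>i<n. card (F i))"
proof -
  have bij: "bij_betw (\<lambda>z i. if i < n then z i else 0) (\<Pi>\<^sub>E i\<in>{..<n}. F i) S"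
  proof (rule bij_betw_byWitness[where f' = "\<lambda>z. restrict z {..<n}"])
    show "\<forall>z\<in>\<Pi>\<^sub>E i\<in>{..<n}. F i. restrict (\<lambda>i. if i < n then z i else 0) {..<n} = z"
    proof
      fix z assume z: "z \<in> (\<Pi>\<^sub>E i\<in>{..<n}. F i)"
      show "restrict (\<lambda>i. if i < n then z i else 0) {..<n} = z"
      proof
        fix i show "restrict (\<lambda>i. if i < n then z i else 0) {..<n} i = z i"
          using PiE_arb[OF z, of i] by (cases "i < n") simp_all
      qed
    qed
    show "\<forall>z\<in>S. (\<lambda>i. if i < n then restrict z {..<n} i else 0) = z"
      by (simp add: S_def fun_eq_iff)
    show "(\<lambda>z i. if i < n then z i else 0) ` (\<Pi>\<^sub>E i\<in>{..<n}. F i) \<subseteq> S"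
      by (rule image_subsetI) (simp add: S_def PiE_mem)
    show "(\<lambda>z. restrict z {..<n}) ` S \<subseteq> (\<Pi>\<^sub>E i\<in>{..<n}. F i)"
      by (rule image_subsetI) (simp add: S_def restrict_PiE_iff)
  qed
  show "finite S"
    using bij_betw_finite[OF bij] fin by (simp add: finite_PiE)
  show "card S = (\<Prod>i<n. card (F i))"
    using bij_betw_same_card[OF bij] by (simp add: card_PiE)
qed

text \<open>Put a separated set into each of the \<open>n\<close> sides of a box inside \<open>V\<close>. Two different points of the
  resulting grid differ in some coordinate, which already separates them for any \<open>D\<close> that dominates
  the coordinate distances.\<close>

lemma open_coord_space_separated:
  fixes V :: "(nat \<Rightarrow> 'k::{zero,metric_space}) set"
  assumes lin: "linearly_packed TYPE('k)"
    and D: "\<And>x y i. i < n \<Longrightarrow> dist (x i) (y i) \<le> D x y"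
    and V: "openin (top_of_set (coord_space n)) V" and ne: "V \<noteq> {}"
  obtains c where "c > 0"
    "\<And>s. s > 0 \<Longrightarrow> \<exists>S. finite S \<and> S \<subseteq> V \<and> separated_by D s S \<and> c / s ^ n \<le> real (card S)"
proof -
  obtain a where a: "a \<in> V"
    using ne by blast
  obtain e where e: "e > 0"
      "\<And>z. z \<in> coord_space n \<Longrightarrow> (\<And>i. i < n \<Longrightarrow> z i \<in> ball (a i) e) \<Longrightarrow> z \<in> V"
    using open_coord_space_contains_box[OF V a] by blast
  obtain c where c: "\<And>i. c i > 0" "\<And>i s. s > 0 \<Longrightarrow> \<exists>F. finite F \<and> F \<subseteq> ball (a i) e \<and>
      separated_by dist s F \<and> c i / s \<le> real (card F)"
  proof -
    have "\<forall>i. \<exists>c>0. \<forall>s>0. \<exists>F. finite F \<and> F \<subseteq> ball (a i) e \<and>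
        separated_by dist s F \<and> c / s \<le> real (card F)"
      using lin e(1) by (simp add: linearly_packed_def)
    from choice[OF this] show ?thesis
      using that by blast
  qed
  have "\<exists>S. finite S \<and> S \<subseteq> V \<and> separated_by D s S \<and> (\<Prod>i<n. c i) / s ^ n \<le> real (card S)"
    if s: "s > 0" for s
  proof -
    have "\<exists>F. \<forall>i. finite (F i) \<and> F i \<subseteq> ball (a i) e \<and> separated_by dist s (F i) \<and>
        c i / s \<le> real (card (F i))"
      by (intro choice allI c(2)[OF s])
    then obtain F where F_all: "\<forall>i. finite (F i) \<and> F i \<subseteq> ball (a i) e \<and> separated_by dist s (F i) \<and>
        c i / s \<le> real (card (F i))" ..
    have F: "finite (F i)" "F i \<subseteq> ball (a i) e" "separated_by dist s (F i)"
        "c i / s \<le> real (card (F i))" for i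
      using F_all by auto
    define S where "S = {z. (\<forall>i<n. z i \<in> F i) \<and> (\<forall>i\<ge>n. z i = 0)}"
    have mem: "z i \<in> F i" if "z \<in> S" "i < n" for z i
      using that by (simp add: S_def)
    have zero: "z i = 0" if "z \<in> S" "i \<ge> n" for z i
      using that by (simp add: S_def)
    have card_S: "finite S" "card S = (\<Prod>i<n. card (F i))"
      unfolding S_def by (rule finite_card_zero_extended, rule F(1))+
    have "S \<subseteq> V"
    proof
      fix z assume z: "z \<in> S"
      show "z \<in> V"
      proof (rule e(2))
        show "z \<in> coord_space n"
          using zero[OF z] by (simp add: coord_space_def)
        show "z i \<in> ball (a i) e" if "i < n" for i
          using mem[OF z that] F(2) by blast
      qed
    qed
    moreover have "separated_by D s S"
      unfolding separated_by_def
    proof (intro ballI impI)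
      fix x y assume xy: "x \<in> S" "y \<in> S" "x \<noteq> y"
      then obtain i where i: "x i \<noteq> y i"
        by (auto simp: fun_eq_iff)
      then have "i < n"
        using zero[OF xy(1), of i] zero[OF xy(2), of i] by (cases "i < n") auto
      then have "s \<le> dist (x i) (y i)"
        using F(3)[of i] i mem xy(1,2) unfolding separated_by_def by blast
      also have "\<dots> \<le> D x y"
        by (rule D) fact
      finally show "s \<le> D x y" .
    qed
    moreover have "(\<Prod>i<n. c i) / s ^ n \<le> real (card S)"
    proof -
      have "(\<Prod>i<n. c i) / s ^ n = (\<Prod>i<n. c i / s)"
        by (simp add: prod_dividef)
      also have "\<dots> \<le> (\<Prod>i<n. real (card (F i)))"
        using F(4) c(1) s by (intro prod_mono) (simp add: less_imp_le)
      finally show ?thesis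
        by (simp add: card_S(2))
    qed
    ultimately show ?thesis
      using card_S(1) by blast
  qed
  moreover have "(\<Prod>i<n. c i) > 0"
    using c(1) by (simp add: prod_pos)
  ultimately show ?thesis
    using that by blast
qed

lemma dist_le_euclidean_dist: "i < n \<Longrightarrow> dist (x i) (y i) \<le> euclidean_dist n x y"
  unfolding euclidean_dist_def dist_real_def
  using member_le_L2_set[of "{..<n}" i "\<lambda>i. \<bar>x i - y i\<bar>"] by (simp add: L2_set_def)

lemma dist_le_max_dist: "i < n \<Longrightarrow> dist (x i) (y i) \<le> max_dist n x y"
  by (simp add: max_dist_def)

section \<open>Lie groups with a compatible metric\<close>

text \<open>The grid is built in the open set \<open>\<phi> ` W\<close> at scale \<open>L s\<close> and pulled back; the estimate
  \<open>D (\<phi> x) (\<phi> y) \<le> L * d x y\<close> makes the pulled back points \<open>s\<close>-separated.\<close>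

lemma compatible_metric_separated:
  fixes G :: "('a, 'b) monoid_scheme" and D :: "(nat \<Rightarrow> 'k::{zero,metric_space}) \<Rightarrow> (nat \<Rightarrow> 'k) \<Rightarrow> real"
  assumes T: "topspace T = carrier G" and comp: "compatible_metric reg D n G T A d"
    and lin: "linearly_packed TYPE('k)"
    and D: "\<And>x y i. i < n \<Longrightarrow> dist (x i) (y i) \<le> D x y"
  obtains c where "c > 0"
    "\<And>s. s > 0 \<Longrightarrow> \<exists>S. S \<subseteq> carrier G \<and> separated_by d s S \<and> c / s ^ n \<le> real (card S)"
proof -
  obtain U \<phi> W L where chart: "coordinate_map reg n T A (U, \<phi>)" and W: "openin T W" "\<one>\<^bsub>G\<^esub> \<in> W" "W \<subseteq> U"
    and L: "L > 0" "\<And>x y. x \<in> W \<Longrightarrow> y \<in> W \<Longrightarrow> D (\<phi> x) (\<phi> y) \<le> L * d x y"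
  proof -
    have "\<exists>U \<phi> W L. coordinate_map reg n T A (U, \<phi>) \<and> openin T W \<and> \<one>\<^bsub>G\<^esub> \<in> W \<and> W \<subseteq> U \<and> L > 0 \<and>
        (\<forall>x\<in>W. \<forall>y\<in>W. D (\<phi> x) (\<phi> y) \<le> L * d x y \<and> d x y \<le> L * D (\<phi> x) (\<phi> y))"
      using comp unfolding compatible_metric_def by (elim conjE)
    then show ?thesis
      by (elim exE conjE) (rule that, assumption+, blast)
  qed
  have \<phi>: "openin (top_of_set (coord_space n)) (\<phi> ` U)"
      "homeomorphic_map (subtopology T U) (top_of_set (\<phi> ` U)) \<phi>"
    using chart by (auto simp: coordinate_map_def topological_chart_def)
  have "openin (subtopology T U) W"
    using W openin_subtopology_Int[of T W U] by (simp add: Int_absorb2)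
  then have "openin (top_of_set (\<phi> ` U)) (\<phi> ` W)"
    using homeomorphic_imp_open_map[OF \<phi>(2)] by (auto simp: open_map_def)
  then have V: "openin (top_of_set (coord_space n)) (\<phi> ` W)"
    using \<phi>(1) openin_trans by blast
  obtain c where c: "c > 0" "\<And>s. s > 0 \<Longrightarrow> \<exists>S. finite S \<and> S \<subseteq> \<phi> ` W \<and> separated_by D s S \<and>
      c / s ^ n \<le> real (card S)"
    using open_coord_space_separated[OF lin D V] W(2) by blast
  have "\<exists>S. S \<subseteq> carrier G \<and> separated_by d s S \<and> c / L ^ n / s ^ n \<le> real (card S)" if s: "s > 0" for s
  proof -
    obtain S where S: "S \<subseteq> \<phi> ` W" "separated_by D (L * s) S" "c / (L * s) ^ n \<le> real (card S)"
      using c(2)[of "L * s"] L s by auto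
    obtain R where R: "R \<subseteq> W" "inj_on \<phi> R" "S = \<phi> ` R"
      using S(1) by (auto simp: subset_image_inj)
    have "separated_by d s R"
      unfolding separated_by_def
    proof (intro ballI impI)
      fix x y assume xy: "x \<in> R" "y \<in> R" "x \<noteq> y"
      then have "L * s \<le> D (\<phi> x) (\<phi> y)"
        using S(2) R(2,3) by (auto simp: separated_by_def inj_on_def)
      also have "\<dots> \<le> L * d x y"
        using L(2) R(1) xy by auto
      finally show "s \<le> d x y"
        using L(1) by simp
    qed
    moreover have "card S = card R"
      using R by (simp add: card_image)
    moreover have "R \<subseteq> carrier G"
      using R(1) openin_subset[OF W(1)] T by auto
    ultimately show ?thesis
      using S(3) by (intro exI[of _ R]) (simp add: power_mult_distrib)
  qed
  moreover have "c / L ^ n > 0"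
    using c(1) L(1) by simp
  ultimately show ?thesis
    using that by blast
qed

lemma compatible_metric_dim_sum_ge:
  fixes G :: "('a, 'b) monoid_scheme" and D :: "(nat \<Rightarrow> 'k::{zero,metric_space}) \<Rightarrow> (nat \<Rightarrow> 'k) \<Rightarrow> real"
  assumes lie: "lie_group reg n G T A" and comp: "compatible_metric reg D n G T A d"
    and lin: "linearly_packed TYPE('k)"
    and D: "\<And>x y i. i < n \<Longrightarrow> dist (x i) (y i) \<le> D x y"
    and X: "X \<subseteq> carrier G" and Y: "Y \<subseteq> carrier G" and XY: "X <#>\<^bsub>G\<^esub> Y = carrier G"
  shows "ereal (real n) \<le> upper_minkowski_dim X d + upper_minkowski_dim Y d"
proof -
  have G: "group G" and T: "topspace T = carrier G"
    using lie by (auto simp: lie_group_def)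
  have M: "Metric_space (carrier G) d"
    using comp by (simp add: compatible_metric_def)
  have inv: "\<And>g x y. g \<in> carrier G \<Longrightarrow> x \<in> carrier G \<Longrightarrow> y \<in> carrier G \<Longrightarrow>
      d (g \<otimes>\<^bsub>G\<^esub> x) (g \<otimes>\<^bsub>G\<^esub> y) = d x y \<and> d (x \<otimes>\<^bsub>G\<^esub> g) (y \<otimes>\<^bsub>G\<^esub> g) = d x y"
    using comp by (simp add: compatible_metric_def)
  have "\<one>\<^bsub>G\<^esub> \<in> X <#>\<^bsub>G\<^esub> Y"
    using G XY by (simp add: group.is_monoid monoid.one_closed)
  then have ne: "X \<noteq> {}" "Y \<noteq> {}"
    by (auto simp: set_mult_def)
  obtain c where c: "c > 0"
      "\<And>s. s > 0 \<Longrightarrow> \<exists>S. S \<subseteq> carrier G \<and> separated_by d s S \<and> c / s ^ n \<le> real (card S)"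
    using compatible_metric_separated[OF T comp lin D] by blast
  show ?thesis
  proof (rule upper_minkowski_dim_sum_ge[OF Metric_space.subspace[OF M X] Metric_space.subspace[OF M Y] ne])
    show "c / 8 ^ n > 0"
      using c by simp
    fix \<delta> :: real and NX NY
    assume \<delta>: "\<delta> > 0" and N: "packing_number X d \<delta> = enat NX" "packing_number Y d \<delta> = enat NY"
    obtain S where S: "S \<subseteq> carrier G" "separated_by d (8 * \<delta>) S" "c / (8 * \<delta>) ^ n \<le> real (card S)"
      using c(2)[of "8 * \<delta>"] \<delta> by auto
    have "card S \<le> NX * NY"
      by (rule separated_card_le_packing_numbers[OF G M inv X Y XY \<delta> N S(1,2)])
    then have "real (card S) \<le> real (NX * NY)"
      by (rule of_nat_mono)
    with S(3) show "c / 8 ^ n / \<delta> ^ n \<le> real (NX * NY)"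
      by (simp add: power_mult_distrib)
  qed
qed

theorem proposition6p4:
  fixes G :: "('a, 'b) monoid_scheme" and T :: "'a topology" and d :: "'a \<Rightarrow> 'a \<Rightarrow> real"
    and n :: nat
    and A :: "('a, real) chart set" and B :: "('a, 'p::prime_card padic) chart set"
  assumes "(compact_real_lie_group n G T A \<and> real_compatible_metric n G T A d) \<or>
           (compact_padic_lie_group n G T B \<and> padic_compatible_metric n G T B d)"
  shows "(\<forall>X Y. X \<subseteq> carrier G \<and> Y \<subseteq> carrier G \<and> X <#>\<^bsub>G\<^esub> Y = carrier G
             \<longrightarrow> upper_minkowski_dim X d + upper_minkowski_dim Y d \<ge> ereal (real n)) \<and>
         (\<forall>X. X \<subseteq> carrier G \<and> X <#>\<^bsub>G\<^esub> X = carrier G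
             \<longrightarrow> upper_minkowski_dim X d \<ge> ereal (real n / 2))"
proof -
  have sum: "ereal (real n) \<le> upper_minkowski_dim X d + upper_minkowski_dim Y d"
    if "X \<subseteq> carrier G" "Y \<subseteq> carrier G" "X <#>\<^bsub>G\<^esub> Y = carrier G" for X Y
    using assms
  proof
    assume *: "compact_real_lie_group n G T A \<and> real_compatible_metric n G T A d"
    show ?thesis
      by (rule compatible_metric_dim_sum_ge[OF _ _ linearly_packed_real dist_le_euclidean_dist that])
         (use * in \<open>auto simp: compact_real_lie_group_def real_compatible_metric_def\<close>)
  next
    assume *: "compact_padic_lie_group n G T B \<and> padic_compatible_metric n G T B d"
    show ?thesis
      by (rule compatible_metric_dim_sum_ge[OF _ _ linearly_packed_padic dist_le_max_dist that])
         (use * in \<open>auto simp: compact_padic_lie_group_def padic_compatible_metric_def\<close>)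
  qed
  have "ereal (real n / 2) \<le> upper_minkowski_dim X d"
    if "X \<subseteq> carrier G" "X <#>\<^bsub>G\<^esub> X = carrier G" for X
    using sum[OF that(1,1,2)] by (cases "upper_minkowski_dim X d") auto
  with sum show ?thesis
    by blast
qed

end
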